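(* Let $n,s,k,r$ be integers with $s\ge 1$, $n\ge 2s+1$ and $k\ge r\ge 3$. Then $$\mathrm{ex}(n,K_r,\{K_{k+1},M_{s+1}\})=\max\{N(T_k(2s+1),K_r),\,N(G_k(n,s),K_r)\}.$$
   Context: For graphs $T$, $G$, $N(G,T)$ denotes the number of (not necessarily induced) copies of $T$ in $G$. For a graph $T$ and a family of graphs $\mathcal{H}$, $\mathrm{ex}(n,T,\mathcal{H})$ is the maximum of $N(G,T)$ over all $n$-vertex graphs $G$ containing no member of $\mathcal{H}$ as a subgraph. $K_{m}$ is the complete graph on $m$ vertices and $M_{m}$ is a matching consisting of $m$ edges. The Turán graph $T_k(m)$ is the complete $k$-partite graph on $m$ vertices whose part sizes are as equal as possible. $G_k(n,s)$ is the join of an empty graph on $n-s$ vertices with $T_{k-1}(s)$, i.e. the complete $k$-partite graph on $n$ vertices with one part of size $n-s$ and the other $k-1$ parts of sizes as equal as possible (summing to $s$). *)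

theory Defs
  imports Main
begin

type_synonym 'a graph = "'a set \<times> 'a set set"

abbreviation verts :: "'a graph \<Rightarrow> 'a set" where
  "verts G \<equiv> fst G"

abbreviation edges :: "'a graph \<Rightarrow> 'a set set" where
  "edges G \<equiv> snd G"

definition simple_graph :: "'a graph \<Rightarrow> bool" where
  "simple_graph G \<longleftrightarrow> finite (verts G) \<and> (\<forall>e\<in>edges G. e \<subseteq> verts G \<and> card e = 2)"

definition subgraph :: "'a graph \<Rightarrow> 'a graph \<Rightarrow> bool" where
  "subgraph H G \<longleftrightarrow> simple_graph H \<and> verts H \<subseteq> verts G \<and> edges H \<subseteq> edges G"

definition isomorphic :: "'a graph \<Rightarrow> 'b graph \<Rightarrow> bool" where
  "isomorphic G H \<longleftrightarrow>
     (\<exists>f. bij_betw f (verts G) (verts H) \<and> (\<lambda>e. f ` e) ` edges G = edges H)"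

text \<open>A copy of \<open>T\<close> in \<open>G\<close> is a subgraph of \<open>G\<close>, not necessarily induced, that is isomorphic
  to \<open>T\<close>; copies are unlabelled, i.e. embeddings with the same image are counted once.\<close>

definition copies :: "'a graph \<Rightarrow> 'b graph \<Rightarrow> 'a graph set" where
  "copies G T = {H. subgraph H G \<and> isomorphic H T}"

definition num_copies :: "'a graph \<Rightarrow> 'b graph \<Rightarrow> nat" where
  "num_copies G T = card (copies G T)"

definition free_of :: "'b graph set \<Rightarrow> 'a graph \<Rightarrow> bool" where
  "free_of \<H> G \<longleftrightarrow> (\<forall>H\<in>\<H>. copies G H = {})"

definition gen_ex :: "nat \<Rightarrow> 'b graph \<Rightarrow> 'c graph set \<Rightarrow> nat" where
  "gen_ex n T \<H> =
     Max {num_copies G T | G :: nat graph. simple_graph G \<and> card (verts G) = n \<and> free_of \<H> G}"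

definition complete_graph :: "nat \<Rightarrow> nat graph" where
  "complete_graph m = ({..<m}, {{i, j} | i j. i < m \<and> j < m \<and> i \<noteq> j})"

definition empty_graph :: "nat \<Rightarrow> nat graph" where
  "empty_graph m = ({..<m}, {})"

definition matching_graph :: "nat \<Rightarrow> nat graph" where
  "matching_graph m = ({..<2 * m}, {{2 * i, 2 * i + 1} | i. i < m})"

text \<open>The parts of the Turan graph are the residue classes modulo \<open>k\<close> in \<open>{..<m}\<close>, whose sizes
  differ by at most one (some are empty if \<open>m < k\<close>). Only meaningful for \<open>k \<ge> 1\<close>.\<close>

definition turan_graph :: "nat \<Rightarrow> nat \<Rightarrow> nat graph" where
  "turan_graph k m = ({..<m}, {{i, j} | i j. i < m \<and> j < m \<and> i mod k \<noteq> j mod k})"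

definition graph_join :: "'a graph \<Rightarrow> 'b graph \<Rightarrow> ('a + 'b) graph" where
  "graph_join G H =
     (Inl ` verts G \<union> Inr ` verts H,
      (\<lambda>e. Inl ` e) ` edges G \<union> (\<lambda>e. Inr ` e) ` edges H
        \<union> {{Inl u, Inr v} | u v. u \<in> verts G \<and> v \<in> verts H})"

definition G_graph :: "nat \<Rightarrow> nat \<Rightarrow> nat \<Rightarrow> (nat + nat) graph" where
  "G_graph k n s = graph_join (empty_graph (n - s)) (turan_graph (k - 1) s)"

lemma simple_graph_complete_graph: "simple_graph (complete_graph m)"
  by (auto simp: simple_graph_def complete_graph_def)

lemma simple_graph_empty_graph: "simple_graph (empty_graph m)"
  by (auto simp: simple_graph_def empty_graph_def)

lemma simple_graph_matching_graph: "simple_graph (matching_graph m)"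
  by (auto simp: simple_graph_def matching_graph_def)

lemma simple_graph_turan_graph: "simple_graph (turan_graph k m)"
  by (auto simp: simple_graph_def turan_graph_def card_2_iff)

lemma simple_graph_graph_join:
  assumes "simple_graph G" "simple_graph H"
  shows "simple_graph (graph_join G H)"
  using assms unfolding simple_graph_def graph_join_def
  by (fastforce simp: card_image)

lemma num_copies_le:
  assumes "simple_graph G"
  shows "num_copies G T \<le> 2 ^ card (verts G) * 2 ^ 2 ^ card (verts G)"
proof -
  let ?V = "verts G"
  have fin: "finite ?V" and sub: "edges G \<subseteq> Pow ?V"
    using assms by (auto simp: simple_graph_def)
  have "copies G T \<subseteq> Pow ?V \<times> Pow (Pow ?V)"
    using sub by (fastforce simp: copies_def subgraph_def)
  then have "card (copies G T) \<le> card (Pow ?V \<times> Pow (Pow ?V))"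
    using fin by (intro card_mono) auto
  then show ?thesis
    using fin by (simp add: num_copies_def card_cartesian_product card_Pow)
qed

text \<open>The maximum in \<open>gen_ex\<close> is over a finite set, although the graphs range over
  infinitely many vertex sets.\<close>

lemma finite_gen_ex_values:
  "finite {num_copies G T | G :: nat graph.
     simple_graph G \<and> card (verts G) = n \<and> free_of \<H> G}"
  by (rule finite_subset[of _ "{..2 ^ n * 2 ^ 2 ^ n}"]) (use num_copies_le in fastforce)+

end

theory Submission
  imports Defs "HOL-Library.Disjoint_Sets"
begin

text \<open>
  Let \<open>T m\<close> be the number of \<open>r\<close>-cliques of the Turan graph \<open>T\<^sub>k(m)\<close> and \<open>e m\<close> the number of
  \<open>(r-1)\<close>-cliques of \<open>T\<^sub>k\<^sub>-\<^sub>1(m)\<close>.  By the Tutte--Berge formula there is a set \<open>B\<close> of \<open>b\<close> vertices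
  and a partition of the other vertices into classes \<open>A\<^sub>i\<close> without edges between them such that
  \<open>b + \<Sum> \<lfloor>|A\<^sub>i| / 2\<rfloor> \<le> s\<close>.  Take the vertex \<open>x\<close> outside \<open>B\<close> lying in the most \<open>r\<close>-cliques, and
  in every class but that of \<open>x\<close> replace all vertices except one by clones of \<open>x\<close>.  The number
  of \<open>r\<close>-cliques does not decrease, and afterwards each remaining vertex of another class has
  all its neighbours in \<open>B\<close>.  Zykov's theorem then gives at most \<open>T m + (n - m) e b\<close> cliques, for
  every \<open>m\<close> between \<open>2s + 1 - b\<close> and \<open>n\<close>.

  Choose \<open>X\<close> such that \<open>T\<^sub>k(X)\<close> without a largest part has \<open>s\<close> vertices; then
  \<open>T X + (n - X) e s\<close> is the number of \<open>r\<close>-cliques of \<open>G\<^sub>k(n, s)\<close>.  If \<open>2s + 1 - b \<le> X\<close>, take \<open>m = X\<close>.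
  Otherwise take \<open>m = 2s + 1 - b\<close>: the bound is a convex function of \<open>b\<close> on \<open>{0..2s + 1 - X}\<close>, it is
  \<open>T (2s + 1)\<close> at the left end and at most \<open>T X + (n - X) e s\<close> at the right end.
\<close>

subsection \<open>Clique numbers of Turan graphs\<close>

text \<open>\<open>tur r k m\<close> counts the \<open>r\<close>-cliques of \<open>T\<^sub>k(m)\<close>: the last vertex of \<open>T\<^sub>k(m + 1)\<close> is adjacent to
  all but \<open>m div k\<close> of the \<open>m\<close> other vertices, and these form a copy of \<open>T\<^sub>k\<^sub>-\<^sub>1(m - m div k)\<close>.\<close>

fun tur :: "nat \<Rightarrow> nat \<Rightarrow> nat \<Rightarrow> nat" where
  "tur 0 k m = 1"
| "tur (Suc r) 0 m = 0"
| "tur (Suc r) (Suc k) 0 = 0"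
| "tur (Suc r) (Suc k) (Suc m) = tur (Suc r) (Suc k) m + tur r k (m - m div Suc k)"

lemma tur_one: "tur (Suc 0) (Suc k) m = m"
  by (induction m) auto

lemma tur_mono: "m \<le> m' \<Longrightarrow> tur r k m \<le> tur r k m'"
proof (induction m' rule: dec_induct)
  case (step m')
  have "tur r k m' \<le> tur r k (Suc m')" by (cases r; cases k) auto
  with step.IH show ?case by simp
qed simp

text \<open>For positive \<open>r\<close> and \<open>k\<close> the increment at \<open>m\<close> is
  a clique count of a Turan graph on \<open>m - m div k\<close> vertices, and this size does not
  decrease as \<open>m\<close> grows.\<close>

lemma tur_convex: "2 * tur r k (Suc m) \<le> tur r k m + tur r k (Suc (Suc m))"
proof (cases r; cases k)
  fix r' k' assume "r = Suc r'" "k = Suc k'"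
  moreover have "m - m div Suc k' \<le> Suc m - Suc m div Suc k'"
    using div_le_dividend[of m "Suc k'"] by (simp add: div_Suc Suc_diff_le)
  then have "tur r' k' (m - m div Suc k') \<le> tur r' k' (Suc m - Suc m div Suc k')"
    by (rule tur_mono)
  ultimately show ?thesis by simp
qed auto

text \<open>A clique takes at most one vertex of a smallest part, which has
  \<open>m div Suc k\<close> vertices, and the rest is a Turan graph with one part fewer. As
  \<open>tur\<close> is only a recursion, the identity is proved by following how one more vertex
  enlarges either the smallest part or the rest.\<close>

lemma tur_remove_smallest_part:
  "tur (Suc r) (Suc k) m =
     tur (Suc r) k (m - m div Suc k) + (m div Suc k) * tur r k (m - m div Suc k)"
proof (induction k arbitrary: r m)
  case 0
  show ?case
  proof (cases r)
    case 0
    then show ?thesis by (simp add: tur_one)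
  next
    case (Suc r')
    then show ?thesis by (induction m) auto
  qed
next
  case (Suc k)
  note IHk = Suc.IH
  show ?case
  proof (induction m)
    case 0
    show ?case by simp
  next
    case (Suc m)
    define w where "w = m div Suc (Suc k)"
    define d where "d = m - w"
    \<comment> \<open>The new vertex is put into the smallest part, so the rest stays at
      \<open>d\<close>.\<close>
    have step: "tur (Suc r) (Suc (Suc k)) (Suc m) =
        tur (Suc r) (Suc k) d + Suc w * tur r (Suc k) d"
      using Suc.IH by (simp add: w_def d_def)
    have wm: "w \<le> m" by (simp add: w_def)
    show ?case
    proof (cases "Suc m mod Suc (Suc k) = 0")
      case True
      then have "Suc m div Suc (Suc k) = Suc w" by (simp add: div_Suc w_def)
      then show ?thesis using step wm by (simp add: d_def)
    next
      case False
      then have w': "Suc m div Suc (Suc k) = w" by (simp add: div_Suc w_def)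
      have md: "m = Suc (Suc k) * w + m mod Suc (Suc k)"
        by (simp only: w_def mult_div_mod_eq)
      have "m mod Suc (Suc k) < Suc k"
        using False by (metis mod_Suc mod_less_divisor less_SucE zero_less_Suc)
      moreover have dd: "d = Suc k * w + m mod Suc (Suc k)"
        using md by (simp add: d_def)
      \<comment> \<open>The rest has smallest part \<open>w\<close> as well. So trading a part of
        size \<open>Suc w\<close> for one of size \<open>w\<close> amounts to the recursion for one
        more vertex of the rest.\<close>
      ultimately have dw: "d div Suc k = w"
        by (metis div_mult_self4 div_less add.right_neutral nat.simps(3) add.commute)
      have S: "Suc m - w = Suc d" using wm by (simp add: d_def)
      have "tur r (Suc k) d + w * tur r (Suc k) d + tur (Suc r) (Suc k) d
          = tur (Suc r) (Suc k) (Suc d) + w * tur r (Suc k) (Suc d)"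
      proof (cases r)
        case 0
        then show ?thesis by (simp add: tur_one)
      next
        case (Suc r')
        have "tur r (Suc k) d = tur r k (d - w) + w * tur r' k (d - w)"
          using IHk[of r' d] dw Suc by simp
        then show ?thesis using Suc dw by (simp add: algebra_simps)
      qed
      then show ?thesis unfolding w' S step by simp
    qed
  qed
qed

lemma tur_remove_largest_part:
  "tur (Suc r) (Suc k) (Suc m) =
     tur (Suc r) k (m - m div Suc k) + Suc (m div Suc k) * tur r k (m - m div Suc k)"
  using tur_remove_smallest_part[of r k m] by simp

text \<open>For positive \<open>k\<close> the left side counts cliques in the join of
  \<open>T_k(d)\<close> with an independent set of \<open>m - d\<close> vertices, and balanced parts
  are best. For small \<open>d\<close> the induction adds a vertex to the independent set; for
  larger \<open>d\<close> moving a vertex from it into \<open>T_k(d)\<close> gains nothing.\<close>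

lemma tur_max:
  "d \<le> m \<Longrightarrow> tur (Suc r) k d + (m - d) * tur r k d \<le> tur (Suc r) (Suc k) m"
proof (induction m arbitrary: d)
  case 0
  then show ?case by (cases k) auto
next
  case (Suc m)
  define q where "q = m - m div Suc k"
  have low: "tur (Suc r) k d + (Suc m - d) * tur r k d \<le> tur (Suc r) (Suc k) (Suc m)"
    if "d \<le> q" for d
  proof -
    have "d \<le> m" using that by (simp add: q_def)
    then have "tur (Suc r) k d + (Suc m - d) * tur r k d
       = (tur (Suc r) k d + (m - d) * tur r k d) + tur r k d"
      by (simp add: Suc_diff_le)
    also have "\<dots> \<le> tur (Suc r) (Suc k) m + tur r k q"
      by (intro add_mono Suc.IH tur_mono \<open>d \<le> m\<close> that)
    finally show ?thesis by (simp add: q_def)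
  qed
  show ?case
  proof (cases "d \<le> q")
    case True
    then show ?thesis by (rule low)
  next
    case False
    then have "q \<le> d" by simp
    then show ?thesis using Suc.prems
    proof (induction d rule: dec_induct)
      case base
      show ?case by (rule low) simp
    next
      case (step d)
      have dm: "d \<le> m" using step.prems by simp
      have "tur (Suc r) k (Suc d) + (Suc m - Suc d) * tur r k (Suc d)
          \<le> tur (Suc r) k d + (Suc m - d) * tur r k d"
      proof (cases k)
        case 0
        then show ?thesis by (cases r) auto
      next
        case (Suc k')
        \<comment> \<open>After the move the independent set has \<open>m - d\<close> vertices, at
          most the size of a smallest part of \<open>T_k(d)\<close>. The moved vertex gives up such
          a part as neighbours and gains only the independent set.\<close>
        have kd: "m - d \<le> d div Suc k'"
        proof -
          define w where "w = m div Suc k"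
          have "m = Suc k * w + m mod Suc k" by (simp only: w_def mult_div_mod_eq)
          then have "q = k * w + m mod Suc k" unfolding q_def w_def[symmetric] by simp
          then have "k * w \<le> d" using step.hyps by simp
          then have "w \<le> d div k" using Suc by (simp add: less_eq_div_iff_mult_less_eq mult.commute)
          moreover have "m - d \<le> w" using step.hyps unfolding q_def w_def[symmetric] by simp
          ultimately show ?thesis using Suc by simp
        qed
        show ?thesis
        proof (cases r)
          case 0
          then show ?thesis using Suc dm by (simp add: tur_one)
        next
          case (Suc r')
          let ?e = "d - d div Suc k'"
          have "tur r k' ?e + (m - d) * tur r' k' ?e \<le> tur r k' ?e + (d div Suc k') * tur r' k' ?e"
            using kd by simp
          also have "\<dots> = tur r k d"
            unfolding Suc \<open>k = Suc k'\<close> by (simp add: tur_remove_smallest_part)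
          finally have "tur r k' ?e + (m - d) * tur r' k' ?e \<le> tur r k d" .
          moreover have "tur (Suc r) k (Suc d) = tur (Suc r) k d + tur r k' ?e"
            using \<open>k = Suc k'\<close> by simp
          moreover have "tur r k (Suc d) = tur r k d + tur r' k' ?e"
            using \<open>k = Suc k'\<close> Suc by simp
          moreover have "Suc m - d = Suc (m - d)" using dm by simp
          ultimately show ?thesis by (simp add: algebra_simps)
        qed
      qed
      also have "\<dots> \<le> tur (Suc r) (Suc k) (Suc m)" using step by simp
      finally show ?case .
    qed
  qed
qed

text \<open>If \<open>f b\<close> exceeded both ends, \<open>f\<close> would increase at some step
  before \<open>b\<close>, by convexity also at every later step, and so
  \<open>f b \<le> f c\<close>.\<close>

lemma convex_le_max_endpoints:
  fixes f :: "nat \<Rightarrow> nat"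
  assumes conv: "\<And>b. Suc b < c \<Longrightarrow> 2 * f (Suc b) \<le> f b + f (Suc (Suc b))" and bc: "b \<le> c"
  shows "f b \<le> max (f 0) (f c)"
proof (rule ccontr)
  assume "\<not> ?thesis"
  then have b0: "f 0 < f b" and b1: "f c < f b" by auto
  have "\<exists>i<b. f i < f (Suc i)"
  proof (rule ccontr)
    assume H: "\<not> ?thesis"
    have "f j \<le> f 0" if "j \<le> b" for j
      using that
    proof (induction j)
      case (Suc j)
      then have "f (Suc j) \<le> f j" using H by (meson Suc_le_eq not_le)
      with Suc show ?case by simp
    qed simp
    with b0 show False by force
  qed
  then obtain i where i: "i < b" "f i < f (Suc i)" by blast
  have up: "f j < f (Suc j)" if "i \<le> j" "j < c" for j
    using that
  proof (induction j rule: dec_induct)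
    case base
    show ?case by (rule i)
  next
    case (step j)
    then have "f j < f (Suc j)" "2 * f (Suc j) \<le> f j + f (Suc (Suc j))"
      using conv by simp_all
    then show ?case by simp
  qed
  have "f b \<le> f j" if "b \<le> j" "j \<le> c" for j
    using that
  proof (induction j rule: dec_induct)
    case (step j)
    have "f j < f (Suc j)" using up[of j] step i by simp
    with step show ?case by simp
  qed simp
  with bc b1 show False by force
qed

subsection \<open>The Tutte--Berge formula\<close>

definition is_matching :: "'a set set \<Rightarrow> 'a set set \<Rightarrow> bool" where
  "is_matching E M \<longleftrightarrow> M \<subseteq> E \<and> disjoint M"

lemma is_matching_insert:
  assumes "is_matching E M" "e \<in> E" "e \<inter> \<Union>M = {}"
  shows "is_matching E (insert e M)"
  using assms by (auto simp: is_matching_def pairwise_insert disjnt_def)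

lemma is_matching_subset: "is_matching E M \<Longrightarrow> N \<subseteq> M \<Longrightarrow> is_matching E N"
  by (auto simp: is_matching_def intro: pairwise_subset)

lemma card_Union_matching:
  assumes "simple_graph (V, E)" "is_matching E M"
  shows "finite M" "finite (\<Union>M)" "card (\<Union>M) = 2 * card M"
proof -
  have V: "finite V" and E: "\<And>e. e \<in> E \<Longrightarrow> e \<subseteq> V \<and> card e = 2"
    using assms(1) by (auto simp: simple_graph_def)
  have "M \<subseteq> Pow V" "\<Union>M \<subseteq> V" using E assms(2) by (auto simp: is_matching_def)
  then show f: "finite M" and "finite (\<Union>M)" using V by (auto intro: finite_subset)
  have "card (\<Union>M) = sum card M"
    using assms(2) E V by (intro card_Union_disjoint) (auto simp: is_matching_def intro: finite_subset)
  also have "\<dots> = (\<Sum>e\<in>M. 2)"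
    using assms(2) E by (intro sum.cong) (auto simp: is_matching_def)
  finally show "card (\<Union>M) = 2 * card M" by simp
qed

text \<open>If every vertex is missed by some maximum matching, then ``equal, or not both missed by any
  maximum matching'' is an equivalence relation on the vertices (Gallai).  The transitivity proof
  takes the maximum matching missing \<open>t\<close> that has most edges in common with \<open>M\<close>, and exchanges an edge.\<close>

lemma missed_by_max_matching_trans:
  assumes G: "simple_graph (V, E)"
    and max: "\<And>M. is_matching E M \<Longrightarrow> card M \<le> \<nu>"
    and miss_t: "is_matching E N\<^sub>0" "card N\<^sub>0 = \<nu>" "t \<notin> \<Union>N\<^sub>0"
    and ut: "\<And>N. is_matching E N \<Longrightarrow> card N = \<nu> \<Longrightarrow> u \<notin> \<Union>N \<Longrightarrow> t \<in> \<Union>N"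
    and vt: "\<And>N. is_matching E N \<Longrightarrow> card N = \<nu> \<Longrightarrow> v \<notin> \<Union>N \<Longrightarrow> t \<in> \<Union>N"
    and M: "is_matching E M" "card M = \<nu>" "u \<notin> \<Union>M" "v \<notin> \<Union>M"
  shows "u = v"
proof (rule ccontr)
  assume uv: "u \<noteq> v"
  define P where "P N \<longleftrightarrow> is_matching E N \<and> card N = \<nu> \<and> t \<notin> \<Union>N" for N
  note finM = card_Union_matching[OF G M(1)]
  obtain N where N: "P N" and Nmax: "\<And>N'. P N' \<Longrightarrow> card (M \<inter> N') \<le> card (M \<inter> N)"
  proof -
    have "\<forall>N. P N \<longrightarrow> card (M \<inter> N) < Suc (card M)"
      using finM(1) by (simp add: card_mono less_Suc_eq_le)
    then show ?thesis
      using ex_has_greatest_nat[of P N\<^sub>0 "\<lambda>N. card (M \<inter> N)" "Suc (card M)"] miss_t that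
      unfolding P_def by blast
  qed
  have Nm: "is_matching E N" and Nc: "card N = \<nu>" and tN: "t \<notin> \<Union>N" using N by (auto simp: P_def)
  note finN = card_Union_matching[OF G Nm]
  \<comment> \<open>\<open>N\<close> misses \<open>t\<close>, so it covers both \<open>u\<close> and
    \<open>v\<close>, which \<open>M\<close> misses. Since \<open>M\<close> and \<open>N\<close>
    cover equally many vertices, at least two vertices, hence one other than \<open>t\<close>, are
    covered by \<open>M\<close> only.\<close>
  have "{u, v} \<subseteq> \<Union>N - \<Union>M" using ut[OF Nm Nc] vt[OF Nm Nc] tN M by blast
  then have "card {u, v} \<le> card (\<Union>N - \<Union>M)" using finN(2) by (intro card_mono) auto
  also have "card (\<Union>N - \<Union>M) = card (\<Union>M - \<Union>N)"
    using finM finN Nc M(2) by (simp add: card_Diff_subset_Int Int_commute)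
  finally have "card (\<Union>M - \<Union>N) \<ge> 2" using uv by simp
  then have "\<not> \<Union>M - \<Union>N \<subseteq> {t}" using card_mono[of "{t}" "\<Union>M - \<Union>N"] by auto
  then obtain x e where x: "x \<noteq> t" "x \<notin> \<Union>N" "x \<in> e" "e \<in> M" by blast
  have eE: "e \<in> E" using x M by (auto simp: is_matching_def)
  then have "card e = 2" using G by (auto simp: simple_graph_def)
  then obtain y where e: "e = {x, y}" "x \<noteq> y" using x(3) by (auto simp: card_2_iff)
  \<comment> \<open>Otherwise \<open>e\<close> could be added to \<open>N\<close>, giving more than
    \<open>\<nu>\<close> edges.\<close>
  have "y \<in> \<Union>N"
  proof (rule ccontr)
    assume "y \<notin> \<Union>N"
    then have "is_matching E (insert e N)" using e x eE Nm by (intro is_matching_insert) auto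
    moreover have "card (insert e N) = Suc \<nu>" using finN(1) Nc x by (subst card_insert_disjoint) auto
    ultimately show False using max by fastforce
  qed
  then obtain f where f: "f \<in> N" "y \<in> f" by blast
  have "f \<noteq> e" using f x by blast
  moreover have "f \<inter> e = {}" if "f \<in> M" "f \<noteq> e"
    using M(1) x(4) that by (simp add: is_matching_def pairwise_def disjnt_def)
  ultimately have fM: "f \<notin> M" using f(2) e(1) by blast
  have yN: "y \<notin> g" if "g \<in> N" "g \<noteq> f" for g
    using Nm f that by (auto simp: is_matching_def pairwise_def disjnt_def)
  \<comment> \<open>Exchanging \<open>f\<close> for \<open>e\<close> keeps the size and still misses
    \<open>t\<close>, but agrees with \<open>M\<close> in one more edge, against the choice of
    \<open>N\<close>.\<close>
  define N' where "N' = insert e (N - {f})"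
  have "is_matching E N'" unfolding N'_def
    using e x eE yN by (intro is_matching_insert is_matching_subset[OF Nm]) auto
  moreover have "e \<notin> N" using x by blast
  then have "card N' = \<nu>" unfolding N'_def
    using finN(1) Nc card_Suc_Diff1[OF finN(1) f(1)] by simp
  moreover have "t \<notin> \<Union>N'" using tN x(1) e \<open>y \<in> \<Union>N\<close> by (auto simp: N'_def)
  ultimately have "P N'" by (simp add: P_def)
  moreover have "M \<inter> N' = insert e (M \<inter> N)" using fM x(4) by (auto simp: N'_def)
  then have "card (M \<inter> N') = Suc (card (M \<inter> N))" using finM(1) \<open>e \<notin> N\<close> by simp
  ultimately show False using Nmax by fastforce
qed

text \<open>The classes are those of the equivalence relation above. No maximum matching misses two
  vertices of one class and no edge joins two classes, so a fixed maximum matching has at least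
  \<open>card A div 2\<close> edges inside each class \<open>A\<close>.\<close>

lemma gallai_partition:
  assumes G: "simple_graph (V, E)"
    and max: "\<And>M. is_matching E M \<Longrightarrow> card M \<le> \<nu>"
    and missed: "\<And>v. v \<in> V \<Longrightarrow> \<exists>M. is_matching E M \<and> card M = \<nu> \<and> v \<notin> \<Union>M"
  shows "\<exists>\<A>. partition_on V \<A> \<and> (\<forall>e\<in>E. \<exists>A\<in>\<A>. e \<subseteq> A) \<and> (\<Sum>A\<in>\<A>. card A div 2) \<le> \<nu>"
proof (cases "V = {}")
  case True
  then have "E = {}" using G by (auto simp: simple_graph_def)
  then show ?thesis using True by (intro exI[of _ "{}"]) (simp add: partition_on_empty)
next
  case False
  have finV: "finite V" and E: "\<And>e. e \<in> E \<Longrightarrow> e \<subseteq> V \<and> card e = 2"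
    using G by (auto simp: simple_graph_def)
  define R where "R = {(u, v). u \<in> V \<and> v \<in> V \<and>
      (u = v \<or> (\<forall>M. is_matching E M \<longrightarrow> card M = \<nu> \<longrightarrow> u \<in> \<Union>M \<or> v \<in> \<Union>M))}"
  have "equiv V R"
  proof (rule equivI)
    show "R \<subseteq> V \<times> V" by (auto simp: R_def)
    show "refl_on V R" by (auto simp: R_def refl_on_def)
    show "sym R" by (auto simp: R_def sym_def)
    show "trans R"
    proof (rule transI)
      fix u t v assume ut: "(u, t) \<in> R" and tv: "(t, v) \<in> R"
      show "(u, v) \<in> R"
      proof (cases "u = t \<or> t = v")
        case True
        then show ?thesis using ut tv by auto
      next
        case False
        have V: "u \<in> V" "t \<in> V" "v \<in> V" using ut tv by (auto simp: R_def)
        obtain N where N: "is_matching E N" "card N = \<nu>" "t \<notin> \<Union>N" using missed[OF V(2)] by blast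
        have 1: "t \<in> \<Union>N" if "is_matching E N" "card N = \<nu>" "u \<notin> \<Union>N" for N
          using that ut False by (auto simp: R_def)
        have 2: "t \<in> \<Union>N" if "is_matching E N" "card N = \<nu>" "v \<notin> \<Union>N" for N
          using that tv False by (auto simp: R_def)
        have "u = v" if "is_matching E M" "card M = \<nu>" "u \<notin> \<Union>M" "v \<notin> \<Union>M" for M
          using missed_by_max_matching_trans[OF G max N 1 2 that] .
        then show ?thesis using V unfolding R_def by blast
      qed
    qed
  qed
  then have part: "partition_on V (V // R)" by (rule partition_on_quotient)
  \<comment> \<open>A maximum matching missing both ends of an edge could be enlarged by it.\<close>
  have inR: "(u, v) \<in> R" if "{u, v} \<in> E" for u v
  proof -
    have "u \<in> \<Union>M \<or> v \<in> \<Union>M" if M: "is_matching E M" "card M = \<nu>" for M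
    proof (rule ccontr)
      assume H: "\<not> ?thesis"
      then have "is_matching E (insert {u, v} M)"
        using M \<open>{u, v} \<in> E\<close> by (intro is_matching_insert) auto
      moreover have "card (insert {u, v} M) = Suc \<nu>"
        using card_Union_matching(1)[OF G M(1)] M(2) H by (subst card_insert_disjoint) auto
      ultimately show False using max by fastforce
    qed
    then show ?thesis using E[OF that] by (auto simp: R_def)
  qed
  have edge: "\<exists>A\<in>V // R. e \<subseteq> A" if "e \<in> E" for e
  proof -
    obtain u v where e: "e = {u, v}" using E \<open>e \<in> E\<close> by (metis card_2_iff)
    then have "(u, v) \<in> R" using inR that by simp
    moreover have "u \<in> V" using E[OF that] e by simp
    moreover from this have "(u, u) \<in> R" by (simp add: R_def)
    ultimately show ?thesis using e by (intro bexI[of _ "R `` {u}"]) (auto intro: quotientI)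
  qed
  obtain M where M: "is_matching E M" "card M = \<nu>" using False missed by blast
  note finM = card_Union_matching[OF G M(1)]
  have disj: "A \<inter> A' = {}" if "A \<in> V // R" "A' \<in> V // R" "A \<noteq> A'" for A A'
    using partition_onD2[OF part] that by (auto simp: pairwise_def disjnt_def)
  have bound: "card A div 2 \<le> card {e \<in> M. e \<subseteq> A}" if A: "A \<in> V // R" for A
  proof -
    have AV: "A \<subseteq> V" using A partition_onD1[OF part] by blast
    have finA: "finite A" using AV finV by (rule finite_subset)
    have "card (A - \<Union>M) \<le> 1"
    proof (rule ccontr)
      assume "\<not> ?thesis"
      then obtain u v where uv: "u \<in> A - \<Union>M" "v \<in> A - \<Union>M" "u \<noteq> v"
        using finA by (metis One_nat_def card_le_Suc0_iff_eq finite_Diff)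
      then have "(u, v) \<in> R" using quotient_eqI[OF \<open>equiv V R\<close> A A]
        by (metis A Diff_iff \<open>equiv V R\<close> quotient_eq_iff)
      then show False using uv M by (auto simp: R_def)
    qed
    \<comment> \<open>Edges of \<open>M\<close> do not leave a class, so covered vertices of
      \<open>A\<close> are covered by edges inside \<open>A\<close>.\<close>
    moreover have "A \<inter> \<Union>M \<subseteq> \<Union>{e \<in> M. e \<subseteq> A}"
    proof
      fix x assume "x \<in> A \<inter> \<Union>M"
      then obtain e where e: "e \<in> M" "x \<in> e" "x \<in> A" by blast
      then obtain A' where "A' \<in> V // R" "e \<subseteq> A'" using edge M unfolding is_matching_def by blast
      then have "e \<subseteq> A" using disj[OF A] e by blast
      then show "x \<in> \<Union>{e \<in> M. e \<subseteq> A}" using e by blast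
    qed
    then have "card (A \<inter> \<Union>M) \<le> 2 * card {e \<in> M. e \<subseteq> A}"
      using card_Union_matching(2,3)[OF G is_matching_subset[OF M(1), of "{e \<in> M. e \<subseteq> A}"]]
      by (metis (no_types, lifting) card_mono mem_Collect_eq subsetI)
    moreover have "card A = card (A \<inter> \<Union>M) + card (A - \<Union>M)"
      using finA by (metis card_Int_Diff)
    ultimately show ?thesis by simp
  qed
  have finQ: "finite (V // R)" using finV part by (rule finite_elements)
  have "(\<Sum>A\<in>V // R. card A div 2) \<le> (\<Sum>A\<in>V // R. card {e \<in> M. e \<subseteq> A})"
    by (intro sum_mono bound)
  also have "\<dots> = card (\<Union>A\<in>V // R. {e \<in> M. e \<subseteq> A})"
  proof (rule card_UN_disjoint[symmetric])
    show "\<forall>A\<in>V // R. \<forall>A'\<in>V // R. A \<noteq> A' \<longrightarrow> {e \<in> M. e \<subseteq> A} \<inter> {e \<in> M. e \<subseteq> A'} = {}"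
    proof (intro ballI impI)
      fix A A' assume "A \<in> V // R" "A' \<in> V // R" "A \<noteq> A'"
      then have "A \<inter> A' = {}" by (rule disj)
      moreover have "e \<noteq> {}" if "e \<in> M" for e
        using E[of e] that M(1) by (auto simp: is_matching_def)
      ultimately show "{e \<in> M. e \<subseteq> A} \<inter> {e \<in> M. e \<subseteq> A'} = {}" by blast
    qed
  qed (use finQ finM in auto)
  also have "\<dots> \<le> card M" using finM(1) by (intro card_mono) auto
  finally show ?thesis using part edge M(2) by blast
qed

text \<open>This is the hard inequality of the formula, with a sum of \<open>card A div 2\<close> in
  place of a count of odd components. A vertex lying in every maximum matching goes into
  \<open>B\<close>, and deleting it lowers the matching number; if there is none, the Gallai classes
  serve with \<open>B\<close> empty.\<close>

theorem tutte_berge: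
  assumes "simple_graph (V, E)" and "\<And>M. is_matching E M \<Longrightarrow> card M \<le> s"
  shows "\<exists>B \<A>. B \<subseteq> V \<and> partition_on (V - B) \<A> \<and>
      (\<forall>e\<in>E. e \<inter> B = {} \<longrightarrow> (\<exists>A\<in>\<A>. e \<subseteq> A)) \<and> card B + (\<Sum>A\<in>\<A>. card A div 2) \<le> s"
  using assms
proof (induction "card V" arbitrary: V E s)
  case 0
  then have "V = {}" by (auto simp: simple_graph_def)
  moreover from this have "E = {}" using 0 by (auto simp: simple_graph_def)
  ultimately show ?case by (intro exI[of _ "{}"]) (auto simp: partition_on_empty)
next
  case (Suc m)
  note G = Suc.prems(1) and le = Suc.prems(2)
  have finV: "finite V" using G by (auto simp: simple_graph_def)
  have "is_matching E {}" by (simp add: is_matching_def)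
  then obtain M where M: "is_matching E M" and max: "\<And>N. is_matching E N \<Longrightarrow> card N \<le> card M"
    using ex_has_greatest_nat[of "is_matching E" "{}" card "Suc s"] le
    by (metis le_imp_less_Suc)
  show ?case
  proof (cases "\<forall>v\<in>V. \<exists>N. is_matching E N \<and> card N = card M \<and> v \<notin> \<Union>N")
    case True
    then obtain \<A> where "partition_on V \<A>" "\<forall>e\<in>E. \<exists>A\<in>\<A>. e \<subseteq> A" "(\<Sum>A\<in>\<A>. card A div 2) \<le> card M"
      using gallai_partition[OF G max] by blast
    then show ?thesis using le[OF M] by (intro exI[of _ "{}"] exI[of _ \<A>]) auto
  next
    case False
    then obtain v where v: "v \<in> V" "\<And>N. is_matching E N \<Longrightarrow> card N = card M \<Longrightarrow> v \<in> \<Union>N" by blast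
    define E' where "E' = {e \<in> E. v \<notin> e}"
    have G': "simple_graph (V - {v}, E')" using G by (auto simp: simple_graph_def E'_def)
    have less: "card N < card M" if "is_matching E' N" for N
    proof -
      have N: "is_matching E N" "v \<notin> \<Union>N" using that by (auto simp: is_matching_def E'_def)
      then show ?thesis using max[OF N(1)] v(2)[OF N(1)] by fastforce
    qed
    have "is_matching E' {}" by (simp add: is_matching_def)
    \<comment> \<open>Positivity keeps the bound \<open>card M - 1\<close> for the smaller graph
      from being truncated, which leaves room for \<open>v\<close> in \<open>B\<close>.\<close>
    then have pos: "0 < card M" using less by fastforce
    have "card N \<le> card M - 1" if "is_matching E' N" for N using less[OF that] by simp
    moreover have "m = card (V - {v})" using Suc.hyps(2) v(1) finV by simp
    ultimately obtain B \<A> where B: "B \<subseteq> V - {v}" "partition_on (V - {v} - B) \<A>"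
      "\<forall>e\<in>E'. e \<inter> B = {} \<longrightarrow> (\<exists>A\<in>\<A>. e \<subseteq> A)" "card B + (\<Sum>A\<in>\<A>. card A div 2) \<le> card M - 1"
      using Suc.hyps(1)[OF _ G'] by blast
    have "V - insert v B = V - {v} - B" by blast
    moreover have "card (insert v B) = Suc (card B)"
      using B(1) finV by (subst card_insert_disjoint) (auto intro: finite_subset)
    ultimately show ?thesis using B pos le[OF M] v(1)
      by (intro exI[of _ "insert v B"] exI[of _ \<A>]) (auto simp: E'_def)
  qed
qed

subsection \<open>Zykov's theorem\<close>

text \<open>The edge set stays fixed while the vertex set varies: these are the cliques of the
  subgraph induced by \<open>V\<close>, so deletions and neighbourhoods only change
  \<open>V\<close>.\<close>

definition cliques :: "'a set set \<Rightarrow> 'a set \<Rightarrow> nat \<Rightarrow> 'a set set" where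
  "cliques E V r = {S. S \<subseteq> V \<and> card S = r \<and> (\<forall>u\<in>S. \<forall>v\<in>S. u \<noteq> v \<longrightarrow> {u, v} \<in> E)}"

definition nbrs :: "'a set set \<Rightarrow> 'a set \<Rightarrow> 'a \<Rightarrow> 'a set" where
  "nbrs E V v = {u \<in> V. u \<noteq> v \<and> {u, v} \<in> E}"

lemma finite_cliques: "finite V \<Longrightarrow> finite (cliques E V r)"
  by (rule finite_subset[of _ "Pow V"]) (auto simp: cliques_def)

lemma finite_nbrs: "finite V \<Longrightarrow> finite (nbrs E V v)"
  by (simp add: nbrs_def)

lemma cliques_mono: "V \<subseteq> W \<Longrightarrow> cliques E V r \<subseteq> cliques E W r"
  by (auto simp: cliques_def)

lemma nbrs_mono: "V \<subseteq> W \<Longrightarrow> nbrs E V v \<subseteq> nbrs E W v"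
  by (auto simp: nbrs_def)

lemma card_cliques_mono: "finite W \<Longrightarrow> V \<subseteq> W \<Longrightarrow> card (cliques E V r) \<le> card (cliques E W r)"
  by (intro card_mono finite_cliques cliques_mono)

lemma card_cliques_0: "finite V \<Longrightarrow> card (cliques E V 0) = 1"
proof -
  assume "finite V"
  then have "cliques E V 0 = {{}}" by (auto simp: cliques_def dest: finite_subset)
  then show ?thesis by simp
qed

lemma cliques_empty_Suc: "cliques E {} (Suc r) = {}"
  by (auto simp: cliques_def)

lemma cliques_insertI:
  assumes "finite V" "S \<in> cliques E (nbrs E V v) r"
  shows "insert v S \<in> cliques E (insert v V) (Suc r)"
proof -
  have "finite S" "v \<notin> S" using assms by (auto simp: cliques_def nbrs_def dest: finite_subset)
  then show ?thesis using assms by (auto simp: cliques_def nbrs_def insert_commute)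
qed

text \<open>The cliques through \<open>v\<close> are those of its neighbourhood with
  \<open>v\<close> added; this is the pattern of the recursion for \<open>tur\<close>.\<close>

lemma card_cliques_insert:
  assumes "finite V" "v \<notin> V"
  shows "card (cliques E (insert v V) (Suc r)) = card (cliques E V (Suc r)) + card (cliques E (nbrs E V v) r)"
proof -
  have "S \<in> cliques E V (Suc r) \<union> insert v ` cliques E (nbrs E V v) r"
    if "S \<in> cliques E (insert v V) (Suc r)" for S
  proof (cases "v \<in> S")
    case True
    have "finite S" using that assms by (auto simp: cliques_def dest: finite_subset)
    then have "S - {v} \<in> cliques E (nbrs E V v) r"
      using that True by (auto simp: cliques_def nbrs_def)
    then show ?thesis using True by (metis UnI2 imageI insert_Diff)
  next
    case False
    then show ?thesis using that by (auto simp: cliques_def)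
  qed
  then have "cliques E (insert v V) (Suc r) = cliques E V (Suc r) \<union> insert v ` cliques E (nbrs E V v) r"
    using cliques_mono[of V "insert v V" E "Suc r"] cliques_insertI[OF assms(1)] by blast
  moreover have "cliques E V (Suc r) \<inter> insert v ` cliques E (nbrs E V v) r = {}"
    using assms(2) by (auto simp: cliques_def)
  moreover have "inj_on (insert v) (cliques E (nbrs E V v) r)"
    by (rule inj_onI) (auto simp: cliques_def nbrs_def)
  ultimately show ?thesis
    using assms(1) by (simp add: card_Un_disjoint finite_cliques finite_nbrs card_image)
qed

text \<open>The vertices outside \<open>D\<close> are added one at a time, each creating at most as
  many cliques as it lies in within all of \<open>V\<close>. This is the inequality behind replacing
  these vertices by clones.\<close>

lemma card_cliques_le_subset:
  assumes "finite V" "D \<subseteq> V" and deg: "\<And>y. y \<in> V - D \<Longrightarrow> card (cliques E (nbrs E V y) r) \<le> \<alpha>"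
  shows "card (cliques E V (Suc r)) \<le> card (cliques E D (Suc r)) + card (V - D) * \<alpha>"
proof -
  have "card (cliques E (D \<union> W) (Suc r)) \<le> card (cliques E D (Suc r)) + card W * \<alpha>"
    if "W \<subseteq> V - D" for W
  proof -
    have "finite W" using that assms(1) by (auto intro: finite_subset)
    then show ?thesis using that
    proof (induction W)
      case empty
      then show ?case by simp
    next
      case (insert y W)
      have fin: "finite (D \<union> W)" using insert assms by (auto intro: finite_subset)
      have "card (cliques E (nbrs E (D \<union> W) y) r) \<le> card (cliques E (nbrs E V y) r)"
        using insert assms by (intro card_cliques_mono finite_nbrs nbrs_mono) auto
      also have "\<dots> \<le> \<alpha>" using insert deg by simp
      finally have "card (cliques E (nbrs E (D \<union> W) y) r) \<le> \<alpha>" .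
      moreover have "y \<notin> D \<union> W" using insert by auto
      ultimately show ?case using insert card_cliques_insert[OF fin, of y E r] by simp
    qed
  qed
  from this[of "V - D"] show ?thesis using assms(2) by (simp add: Un_absorb1)
qed

lemma cliques_nbrs_empty:
  assumes "finite V" "v \<in> V" "cliques E V (Suc k) = {}"
  shows "cliques E (nbrs E V v) k = {}"
proof (rule ccontr)
  assume "\<not> ?thesis"
  then obtain S where "S \<in> cliques E (nbrs E V v) k" by blast
  then show False using cliques_insertI[OF assms(1)] assms(2,3) by (metis empty_iff insert_absorb)
qed

text \<open>Every vertex outside the neighbourhood \<open>D\<close> of a vertex \<open>y\<close> in
  most cliques, and every clone of \<open>x\<close>, is charged at the rate of \<open>y\<close>. The
  result is bounded by \<open>D\<close> joined to \<open>card V + c - card D\<close> independent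
  vertices, where the bound for \<open>D\<close> and \<open>tur_max\<close> apply. That bound is an
  assumption so that the step serves both the induction and the version with clones.\<close>

lemma zykov_step:
  assumes IH: "\<And>D r. finite D \<Longrightarrow> cliques E D (Suc k) = {} \<Longrightarrow> card (cliques E D r) \<le> tur r k (card D)"
    and V: "finite V" "cliques E V (Suc (Suc k)) = {}" "x \<in> V"
  shows "card (cliques E V (Suc r)) + c * card (cliques E (nbrs E V x) r) \<le> tur (Suc r) (Suc k) (card V + c)"
proof -
  define deg where "deg y = card (cliques E (nbrs E V y) r)" for y
  have "Max (deg ` V) \<in> deg ` V" using V by (intro Max_in) auto
  then obtain y where "y \<in> V" "Max (deg ` V) = deg y" by blast
  then have y: "y \<in> V" "\<And>z. z \<in> V \<Longrightarrow> deg z \<le> deg y" using V(1) by (auto simp flip: \<open>Max _ = _\<close>)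
  define D where "D = nbrs E V y"
  have DV: "D \<subseteq> V" "finite D" using V(1) by (auto simp: D_def nbrs_def)
  have D: "cliques E D (Suc k) = {}" unfolding D_def by (rule cliques_nbrs_empty) (use V y in auto)
  have cD: "card D \<le> card V" using DV V by (intro card_mono)
  have "card (cliques E V (Suc r)) \<le> card (cliques E D (Suc r)) + card (V - D) * deg y"
    using V DV y by (intro card_cliques_le_subset) (auto simp: deg_def)
  moreover have "c * deg x \<le> c * deg y" using y V by simp
  moreover have "card V + c - card D = card (V - D) + c" using DV cD by (simp add: card_Diff_subset)
  ultimately have "card (cliques E V (Suc r)) + c * deg x
      \<le> card (cliques E D (Suc r)) + (card V + c - card D) * deg y"
    by (simp only:) (unfold add_mult_distrib, linarith)
  also have "\<dots> \<le> tur (Suc r) k (card D) + (card V + c - card D) * tur r k (card D)"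
    unfolding deg_def D_def[symmetric] using IH[OF DV(2) D] by (intro add_mono mult_mono) auto
  also have "\<dots> \<le> tur (Suc r) (Suc k) (card V + c)" using cD by (intro tur_max) simp
  finally show ?thesis by (simp add: deg_def)
qed

theorem zykov:
  assumes "finite V" "cliques E V (Suc k) = {}"
  shows "card (cliques E V r) \<le> tur r k (card V)"
  using assms
proof (induction k arbitrary: V r)
  case 0
  have "V = {}"
  proof (rule ccontr)
    assume "V \<noteq> {}"
    then obtain v where "v \<in> V" by blast
    then have "{v} \<in> cliques E V (Suc 0)" by (simp add: cliques_def)
    then show False using 0 by simp
  qed
  then show ?case by (cases r) (simp_all add: card_cliques_0 cliques_empty_Suc)
next
  case (Suc k)
  show ?case
  proof (cases r)
    case 0
    then show ?thesis using Suc.prems by (simp add: card_cliques_0)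
  next
    case r: (Suc r')
    show ?thesis
    proof (cases "V = {}")
      case True
      then show ?thesis using r by (simp add: cliques_empty_Suc)
    next
      case False
      then obtain x where "x \<in> V" by blast
      then show ?thesis using zykov_step[OF Suc.IH Suc.prems, where c = 0] r by simp
    qed
  qed
qed

text \<open>The extra term counts the cliques gained by adding \<open>c\<close> clones of \<open>x\<close>.\<close>

lemma zykov_clones:
  assumes "finite V" "cliques E V (Suc k) = {}" "x \<in> V"
  shows "card (cliques E V (Suc r)) + c * card (cliques E (nbrs E V x) r) \<le> tur (Suc r) k (card V + c)"
proof (cases k)
  case 0
  have "{x} \<in> cliques E V (Suc 0)" using assms by (simp add: cliques_def)
  then show ?thesis using 0 assms by simp
next
  case (Suc k')
  then show ?thesis using zykov_step[OF zykov] assms by metis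
qed

subsection \<open>Cliques and matchings as copies\<close>

definition bichromatic :: "('a \<Rightarrow> 'c) \<Rightarrow> 'a set set" where
  "bichromatic c = {{u, v} | u v. c u \<noteq> c v}"

lemma in_bichromatic [simp]: "{u, v} \<in> bichromatic c \<longleftrightarrow> c u \<noteq> c v"
  by (auto simp: bichromatic_def doubleton_eq_iff)

lemma inj_on_clique_bichromatic: "S \<in> cliques (bichromatic c) V r \<Longrightarrow> inj_on c S"
  by (auto simp: cliques_def inj_on_def)

lemma card_cliques_add_colour_class:
  assumes "finite W" "finite P" "\<And>p. p \<in> P \<Longrightarrow> c p = i" "\<And>w. w \<in> W \<Longrightarrow> c w \<noteq> i"
  shows "card (cliques (bichromatic c) (W \<union> P) (Suc r)) =
     card (cliques (bichromatic c) W (Suc r)) + card P * card (cliques (bichromatic c) W r)"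
  using assms(2,3)
proof (induction P)
  case empty
  then show ?case by simp
next
  case (insert p P)
  have "nbrs (bichromatic c) (W \<union> P) p = W"
    using insert.prems assms(4) by (auto simp: nbrs_def)
  moreover have "p \<notin> W \<union> P" using insert assms(4) by auto
  moreover have "finite (W \<union> P)" using insert assms by simp
  ultimately show ?case
    using insert card_cliques_insert[of "W \<union> P" p "bichromatic c" r] by simp
qed

text \<open>This ties the recursion \<open>tur\<close> to actual graphs. The induction removes a
  smallest colour class, to match \<open>tur_remove_smallest_part\<close>. Colours with an empty
  class are allowed, which covers the case of fewer vertices than parts.\<close>

lemma card_cliques_balanced:
  assumes "finite V" "finite C" "c ` V \<subseteq> C"
    and "\<And>i j. i \<in> C \<Longrightarrow> j \<in> C \<Longrightarrow> card {v \<in> V. c v = i} \<le> Suc (card {v \<in> V. c v = j})"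
  shows "card (cliques (bichromatic c) V r) = tur r (card C) (card V)"
  using assms(2,1,3,4)
proof (induction "card C" arbitrary: C V r)
  case 0
  then have "V = {}" by auto
  then show ?case using 0 by (cases r) (simp_all add: card_cliques_0 cliques_empty_Suc)
next
  case (Suc k)
  define sz where "sz i = card {v \<in> V. c v = i}" for i
  have C: "C \<noteq> {}" "finite C" using Suc.hyps(2) Suc.prems by auto
  then have "Min (sz ` C) \<in> sz ` C" by (intro Min_in) auto
  then obtain i where "i \<in> C" "Min (sz ` C) = sz i" by blast
  then have i: "i \<in> C" "\<And>j. j \<in> C \<Longrightarrow> sz i \<le> sz j" using C(2) by (auto simp flip: \<open>Min _ = _\<close>)
  define P where "P = {v \<in> V. c v = i}"
  define W where "W = V - P"
  have k: "card (C - {i}) = k" using Suc.hyps(2) i by simp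
  have "V = (\<Union>j\<in>C. {v \<in> V. c v = j})" using Suc.prems by auto
  then have "card V = card (\<Union>j\<in>C. {v \<in> V. c v = j})" by simp
  also have "\<dots> = sum sz C" unfolding sz_def using Suc.prems by (intro card_UN_disjoint) auto
  also have "\<dots> = sz i + sum sz (C - {i})" using C(2) i(1) by (simp add: sum.remove)
  finally have V: "card V = sz i + sum sz (C - {i})" .
  have "sum sz (C - {i}) \<ge> k * sz i"
    using sum_bounded_below[of "C - {i}" "sz i" sz] i k by simp
  moreover have "sum sz (C - {i}) \<le> k * Suc (sz i)"
    using sum_bounded_above[of "C - {i}" sz "Suc (sz i)"] Suc.prems(4) i(1) k by (simp add: sz_def)
  \<comment> \<open>All class sizes lie between \<open>sz i\<close> and \<open>Suc (sz i)\<close>,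
    and class \<open>i\<close> itself attains the lower value; this makes the second inequality
    strict and determines the quotient.\<close>
  ultimately have "Suc k * sz i \<le> card V" "card V < Suc k * Suc (sz i)"
    using V by simp_all
  then have P: "card P = card V div Suc k"
    unfolding P_def sz_def[symmetric] by (metis div_nat_eqI mult.commute)
  have finP: "finite P" "finite W" "P \<subseteq> V" using Suc.prems by (auto simp: P_def W_def)
  have cW: "card W = card V - card V div Suc k" using finP P by (simp add: W_def card_Diff_subset)
  have part: "{v \<in> W. c v = j} = {v \<in> V. c v = j}" if "j \<in> C - {i}" for j
    using that by (auto simp: W_def P_def)
  have IH: "card (cliques (bichromatic c) W r) = tur r k (card W)" for r
  proof -
    have "c ` W \<subseteq> C - {i}" using Suc.prems(3) by (auto simp: W_def P_def)
    then have "card (cliques (bichromatic c) W r) = tur r (card (C - {i})) (card W)"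
      using C(2) finP(2) Suc.prems(4) k by (intro Suc.hyps(1)) (simp_all add: part)
    then show ?thesis using k by simp
  qed
  show ?case
  proof (cases r)
    case 0
    then show ?thesis using Suc.prems by (simp add: card_cliques_0)
  next
    case (Suc r')
    have "W \<union> P = V" using finP by (auto simp: W_def)
    moreover have "c p = i" if "p \<in> P" for p using that by (simp add: P_def)
    moreover have "c w \<noteq> i" if "w \<in> W" for w using that by (simp add: P_def W_def)
    ultimately have "card (cliques (bichromatic c) V r) =
       card (cliques (bichromatic c) W (Suc r')) + card P * card (cliques (bichromatic c) W r')"
      using card_cliques_add_colour_class[OF finP(2,1), of c i r'] Suc by simp
    also have "\<dots> = tur (Suc r') (Suc k) (card V)"
      unfolding IH cW P by (simp only: tur_remove_smallest_part)
    finally show ?thesis using Suc \<open>Suc k = card C\<close> by simp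
  qed
qed

lemma card_residue_class:
  assumes "j < k"
  shows "card {i \<in> {..<m}. i mod k = j} = m div k + (if j < m mod k then 1 else 0)"
proof (induction m)
  case (Suc m)
  have "{i \<in> {..<Suc m}. i mod k = j} =
      (if m mod k = j then insert m {i \<in> {..<m}. i mod k = j} else {i \<in> {..<m}. i mod k = j})"
    by (auto simp: less_Suc_eq)
  then have "card {i \<in> {..<Suc m}. i mod k = j} =
      card {i \<in> {..<m}. i mod k = j} + (if m mod k = j then 1 else 0)" by simp
  then show ?case using Suc assms by (auto simp: div_Suc mod_Suc)
qed simp

lemma card_cliques_residues:
  assumes "k > 0"
  shows "card (cliques (bichromatic (\<lambda>i. i mod k)) {..<m} r) = tur r k m"
proof -
  have "card {i \<in> {..<m}. i mod k = j} \<le> Suc (card {i \<in> {..<m}. i mod k = j'})"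
    if "j \<in> {..<k}" "j' \<in> {..<k}" for j j'
    using that card_residue_class[of j k m] card_residue_class[of j' k m] by simp
  moreover have "(\<lambda>i. i mod k) ` {..<m} \<subseteq> {..<k}" using assms by auto
  ultimately show ?thesis
    using card_cliques_balanced[of "{..<m}" "{..<k}" "\<lambda>i. i mod k" r] by simp
qed

lemma cliques_cong:
  assumes "\<And>u v. u \<in> V \<Longrightarrow> v \<in> V \<Longrightarrow> u \<noteq> v \<Longrightarrow> {u, v} \<in> E \<longleftrightarrow> {u, v} \<in> E'"
  shows "cliques E V r = cliques E' V r"
  unfolding cliques_def
proof (intro Collect_cong conj_cong refl)
  fix S assume "S \<subseteq> V"
  then have "u \<noteq> v \<longrightarrow> ({u, v} \<in> E \<longleftrightarrow> {u, v} \<in> E')" if "u \<in> S" "v \<in> S" for u v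
    using assms that by blast
  then show "(\<forall>u\<in>S. \<forall>v\<in>S. u \<noteq> v \<longrightarrow> {u, v} \<in> E) = (\<forall>u\<in>S. \<forall>v\<in>S. u \<noteq> v \<longrightarrow> {u, v} \<in> E')"
    by simp
qed

section \<open>Copies of complete graphs and of matchings\<close>

definition all_pairs :: "'a set \<Rightarrow> 'a set set" where
  "all_pairs S = {{u, v} | u v. u \<in> S \<and> v \<in> S \<and> u \<noteq> v}"

lemma all_pairs_image:
  assumes "inj_on f S"
  shows "(`) f ` all_pairs S = all_pairs (f ` S)"
proof
  show "(`) f ` all_pairs S \<subseteq> all_pairs (f ` S)"
  proof
    fix e assume "e \<in> (`) f ` all_pairs S"
    then obtain u v where "e = {f u, f v}" "u \<in> S" "v \<in> S" "u \<noteq> v" by (auto simp: all_pairs_def)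
    moreover from this have "f u \<noteq> f v" using assms by (simp add: inj_on_eq_iff)
    ultimately show "e \<in> all_pairs (f ` S)" unfolding all_pairs_def by blast
  qed
  show "all_pairs (f ` S) \<subseteq> (`) f ` all_pairs S"
  proof
    fix e assume "e \<in> all_pairs (f ` S)"
    then obtain u v where "e = f ` {u, v}" "u \<in> S" "v \<in> S" "u \<noteq> v" by (auto simp: all_pairs_def)
    then show "e \<in> (`) f ` all_pairs S" unfolding all_pairs_def by blast
  qed
qed

lemma complete_graph_eq: "complete_graph r = ({..<r}, all_pairs {..<r})"
  by (simp add: complete_graph_def all_pairs_def)

text \<open>A copy of a complete graph contains every pair of its vertices, so an unlabelled copy is
  determined by its vertex set.\<close>

lemma copies_complete_graph:
  assumes "simple_graph G"
  shows "copies G (complete_graph r) = (\<lambda>S. (S, all_pairs S)) ` cliques (edges G) (verts G) r"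
proof (intro equalityI subsetI)
  fix H assume "H \<in> copies G (complete_graph r)"
  then obtain f where H: "simple_graph H" "verts H \<subseteq> verts G" "edges H \<subseteq> edges G"
    and f: "bij_betw f (verts H) {..<r}" "(`) f ` edges H = all_pairs {..<r}"
    by (auto simp: copies_def subgraph_def isomorphic_def complete_graph_eq)
  let ?S = "verts H"
  have inj: "inj_on f ?S" and img: "f ` ?S = {..<r}" using f(1) by (auto simp: bij_betw_def)
  have pw: "edges H \<subseteq> Pow ?S" using H(1) by (auto simp: simple_graph_def)
  have "all_pairs ?S \<subseteq> Pow ?S" by (auto simp: all_pairs_def)
  moreover have "(`) f ` edges H = (`) f ` all_pairs ?S"
    using f(2) all_pairs_image[OF inj] img by simp
  \<comment> \<open>\<open>f\<close> is injective on vertices, hence on sets of vertices, so edge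
    sets with equal images are equal.\<close>
  ultimately have eq: "edges H = all_pairs ?S"
    using inj_on_image_eq_iff[OF inj_on_image_Pow[OF inj] pw, of "all_pairs ?S"] by simp
  have "card ?S = r" using f(1) bij_betw_same_card by fastforce
  moreover have "\<forall>u\<in>?S. \<forall>v\<in>?S. u \<noteq> v \<longrightarrow> {u, v} \<in> edges G"
    using H(3) eq by (auto simp: all_pairs_def)
  ultimately have "?S \<in> cliques (edges G) (verts G) r" using H(2) by (simp add: cliques_def)
  moreover have "H = (?S, all_pairs ?S)" using eq by (metis prod.collapse)
  ultimately show "H \<in> (\<lambda>S. (S, all_pairs S)) ` cliques (edges G) (verts G) r" by blast
next
  fix H assume "H \<in> (\<lambda>S. (S, all_pairs S)) ` cliques (edges G) (verts G) r"
  then obtain S where H: "H = (S, all_pairs S)" and S: "S \<in> cliques (edges G) (verts G) r" by blast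
  have fin: "finite S" using S assms by (auto simp: cliques_def simple_graph_def dest: finite_subset)
  then obtain f where f: "bij_betw f S {0..<card S}" using ex_bij_betw_finite_nat by blast
  have r: "card S = r" using S by (simp add: cliques_def)
  have "(`) f ` all_pairs S = all_pairs {..<r}"
    using all_pairs_image[of f S] f r by (simp add: bij_betw_def lessThan_atLeast0)
  then have "isomorphic H (complete_graph r)"
    using f r by (auto simp: isomorphic_def complete_graph_eq H lessThan_atLeast0)
  moreover have "subgraph H G"
    using S fin by (auto simp: subgraph_def simple_graph_def H all_pairs_def cliques_def)
  ultimately show "H \<in> copies G (complete_graph r)" by (simp add: copies_def)
qed

lemma num_copies_complete_graph:
  "simple_graph G \<Longrightarrow> num_copies G (complete_graph r) = card (cliques (edges G) (verts G) r)"
  by (simp add: num_copies_def copies_complete_graph card_image inj_on_def)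

lemma matching_edge_eqI:
  fixes i j x :: nat
  assumes "x \<in> {2 * i, 2 * i + 1}" "x \<in> {2 * j, 2 * j + 1}"
  shows "i = j"
  using assms by auto

lemma copy_of_matching_graphD:
  assumes "H \<in> copies G (matching_graph m)"
  shows "is_matching (edges G) (edges H)" "card (edges H) = m"
proof -
  obtain f where H: "simple_graph H" "edges H \<subseteq> edges G"
    and f: "inj_on f (verts H)" "(`) f ` edges H = {{2 * i, 2 * i + 1} | i. i < m}"
    using assms by (auto simp: copies_def subgraph_def isomorphic_def matching_graph_def bij_betw_def)
  have pw: "edges H \<subseteq> Pow (verts H)" using H(1) by (auto simp: simple_graph_def)
  then have inj: "inj_on ((`) f) (edges H)" using inj_on_image_Pow[OF f(1)] by (rule inj_on_subset[rotated])
  have "e \<inter> e' = {}" if e: "e \<in> edges H" "e' \<in> edges H" "e \<noteq> e'" for e e'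
  proof (rule ccontr)
    assume "e \<inter> e' \<noteq> {}"
    then obtain x where x: "x \<in> e" "x \<in> e'" by blast
    have "f ` e \<in> {{2 * i, 2 * i + 1} | i. i < m}" "f ` e' \<in> {{2 * i, 2 * i + 1} | i. i < m}"
      using f(2) imageI[OF e(1), of "(`) f"] imageI[OF e(2), of "(`) f"] by simp_all
    then obtain i j where ij: "f ` e = {2 * i, 2 * i + 1}" "f ` e' = {2 * j, 2 * j + 1}" by blast
    moreover have "f x \<in> f ` e" "f x \<in> f ` e'" using x by simp_all
    ultimately have "i = j" by (intro matching_edge_eqI[of "f x"]) simp_all
    then have "f ` e = f ` e'" using ij by simp
    then show False using inj_onD[OF inj _ e(1,2)] e(3) by simp
  qed
  then show "is_matching (edges G) (edges H)"
    using H(2) by (auto simp: is_matching_def pairwise_def disjnt_def)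
  have "card (edges H) = card {{2 * i, 2 * i + 1} | i. i < m}"
    using card_image[OF inj] f(2) by simp
  also have "{{2 * i, 2 * i + 1} | i. i < m} = (\<lambda>i. {2 * i, 2 * i + 1}) ` {..<m}" by auto
  also have "card \<dots> = m"
  proof -
    have "inj_on (\<lambda>i::nat. {2 * i, 2 * i + 1}) {..<m}"
    proof (rule inj_onI)
      fix i j :: nat assume "{2 * i, 2 * i + 1} = {2 * j, 2 * j + 1}"
      then show "i = j" using matching_edge_eqI[of "2 * i" i j] by blast
    qed
    then show ?thesis by (simp add: card_image)
  qed
  finally show "card (edges H) = m" .
qed

lemma copies_matching_graph_nonempty:
  assumes G: "simple_graph G" and M: "is_matching (edges G) M" "card M = m"
  shows "copies G (matching_graph m) \<noteq> {}"
proof -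
  have G': "simple_graph (verts G, edges G)" using G by simp
  have E: "\<And>e. e \<in> edges G \<Longrightarrow> e \<subseteq> verts G \<and> card e = 2" using G by (auto simp: simple_graph_def)
  have finM: "finite M" "finite (\<Union>M)" using card_Union_matching[OF G' M(1)] by auto
  obtain h where h: "bij_betw h {..<m} M"
    using ex_bij_betw_nat_finite[OF finM(1)] M(2) by (auto simp: lessThan_atLeast0)
  have hM: "h i \<in> M" if "i < m" for i using h that by (auto simp: bij_betw_def)
  have "\<exists>a b. h i = {a, b} \<and> a \<noteq> b" if "i < m" for i
    using E[of "h i"] hM[OF that] M(1) by (auto simp: is_matching_def card_2_iff)
  then obtain a b where ab: "\<And>i. i < m \<Longrightarrow> h i = {a i, b i} \<and> a i \<noteq> b i" by metis
  \<comment> \<open>The vertices \<open>2 * i\<close> and \<open>2 * i + 1\<close> of the model go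
    to the two ends of the edge \<open>h i\<close>. The isomorphism wanted is the inverse of this
    map.\<close>
  define g where "g j = (if even j then a (j div 2) else b (j div 2))" for j
  have gin: "g j \<in> h (j div 2)" if "j < 2 * m" for j
    using ab[of "j div 2"] that by (auto simp: g_def)
  have "inj_on g {..<2 * m}"
  proof (rule inj_onI)
    fix i j assume ij: "i \<in> {..<2 * m}" "j \<in> {..<2 * m}" "g i = g j"
    then have lt: "i div 2 < m" "j div 2 < m" by auto
    have "h (i div 2) \<inter> h (j div 2) \<noteq> {}" using gin[of i] gin[of j] ij by auto
    then have "h (i div 2) = h (j div 2)"
      using M(1) hM lt unfolding is_matching_def pairwise_def disjnt_def by blast
    then have d: "i div 2 = j div 2" using h lt by (auto simp: bij_betw_def dest: inj_onD)
    then have "even i = even j" using ij(3) ab[OF lt(1)] by (auto simp: g_def split: if_splits)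
    then show "i = j" using d by (metis div_mult_mod_eq even_iff_mod_2_eq_zero not_mod_2_eq_0_eq_1)
  qed
  moreover have img: "g ` {2 * i, 2 * i + 1} = h i" if "i < m" for i
    using ab[OF that] by (auto simp: g_def)
  have "{..<2 * m} = (\<Union>i<m. {2 * i, 2 * i + 1})"
  proof (intro equalityI subsetI)
    fix j assume "j \<in> {..<2 * m}"
    then have "j div 2 < m" "j \<in> {2 * (j div 2), 2 * (j div 2) + 1}" by auto
    then show "j \<in> (\<Union>i<m. {2 * i, 2 * i + 1})" by blast
  qed auto
  then have "g ` {..<2 * m} = (\<Union>i<m. h i)" using img by (simp only: image_UN) auto
  then have "g ` {..<2 * m} = \<Union>M" using h by (auto simp: bij_betw_def)
  ultimately have g: "bij_betw g {..<2 * m} (\<Union>M)" by (simp add: bij_betw_def)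
  define f where "f = inv_into {..<2 * m} g"
  have f: "bij_betw f (\<Union>M) {..<2 * m}" unfolding f_def by (rule bij_betw_inv_into[OF g])
  have "f ` h i = {2 * i, 2 * i + 1}" if "i < m" for i
    unfolding img[OF that, symmetric] f_def using that g
    by (intro inv_into_image_cancel) (auto simp: bij_betw_def)
  then have "(\<lambda>i. f ` h i) ` {..<m} = (\<lambda>i. {2 * i, 2 * i + 1}) ` {..<m}"
    by (intro image_cong) auto
  moreover have "M = h ` {..<m}" using h by (simp add: bij_betw_def)
  ultimately have "(`) f ` M = (\<lambda>i. {2 * i, 2 * i + 1}) ` {..<m}" by (simp add: image_image)
  moreover have "{{2 * i, 2 * i + 1} | i. i < m} = (\<lambda>i. {2 * i, 2 * i + 1}) ` {..<m}" by auto
  ultimately have "(`) f ` M = {{2 * i, 2 * i + 1} | i. i < m}" by simp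
  then have "isomorphic (\<Union>M, M) (matching_graph m)"
    unfolding isomorphic_def matching_graph_def using f by (intro exI[of _ f]) simp
  moreover have "subgraph (\<Union>M, M) G"
    using M(1) E finM by (auto simp: subgraph_def simple_graph_def is_matching_def)
  ultimately show ?thesis unfolding copies_def by blast
qed

subsection \<open>Graphs with bounded matching number\<close>

text \<open>\<open>M\<close> is the number of vertices that remain, clones of \<open>x\<close>
  included, when \<open>card V - M\<close> representatives of other classes are peeled off. Each
  peeled vertex sees only \<open>B\<close>, and the remainder is bounded by
  \<open>zykov_clones\<close>.\<close>

lemma card_cliques_le_barrier:
  assumes G: "simple_graph (V, E)" and free: "cliques E V (Suc (Suc k)) = {}"
    and B: "B \<subseteq> V" and part: "partition_on (V - B) \<A>"
    and edge: "\<forall>e\<in>E. e \<inter> B = {} \<longrightarrow> (\<exists>A\<in>\<A>. e \<subseteq> A)"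
    and def: "card B + (\<Sum>A\<in>\<A>. card A div 2) \<le> s"
    and M: "2 * s + 1 - card B \<le> M" "M \<le> card V"
  shows "card (cliques E V (Suc r)) \<le> tur (Suc r) (Suc k) M + (card V - M) * tur r k (card B)"
proof -
  have finV: "finite V" using G by (simp add: simple_graph_def)
  have finB: "finite B" using B finV by (rule finite_subset)
  define deg where "deg y = card (cliques E (nbrs E V y) r)" for y
  have "card B < card V" using def M by simp
  then have "V - B \<noteq> {}" by (metis Diff_eq_empty_iff card_mono finB leD)
  then have "Max (deg ` (V - B)) \<in> deg ` (V - B)" using finV by (intro Max_in) auto
  then obtain x where "x \<in> V - B" "Max (deg ` (V - B)) = deg x" by blast
  then have x: "x \<in> V - B" "\<And>y. y \<in> V - B \<Longrightarrow> deg y \<le> deg x"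
    using finV by (auto simp flip: \<open>Max _ = _\<close>)
  have UA: "\<Union>\<A> = V - B" using partition_onD1[OF part] by simp
  have disj: "A = A'" if "A \<in> \<A>" "A' \<in> \<A>" "a \<in> A" "a \<in> A'" for A A' a
    using partition_onD2[OF part] that by (auto simp: pairwise_def disjnt_def)
  have finA: "finite \<A>" using part finV by (auto intro: finite_elements)
  have finAi: "finite A" if "A \<in> \<A>" for A using that UA finV by (metis Union_upper finite_Diff finite_subset)
  have nonempty: "A \<noteq> {}" if "A \<in> \<A>" for A using that partition_onD3[OF part] by blast
  have nb: "nbrs E V y \<subseteq> B \<union> A" if "A \<in> \<A>" "y \<in> A" for A y
  proof
    fix u assume u: "u \<in> nbrs E V y"
    show "u \<in> B \<union> A"
    proof (cases "u \<in> B")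
      case False
      have "y \<notin> B" using that UA by blast
      then obtain A' where "A' \<in> \<A>" "{u, y} \<subseteq> A'"
        using edge u False by (auto simp: nbrs_def)
      then show ?thesis using disj[OF that(1), of A' y] that by auto
    qed simp
  qed
  obtain A1 where A1: "A1 \<in> \<A>" "x \<in> A1" using x(1) UA by blast
  define z where "z A = (SOME a. a \<in> A)" for A :: "'a set"
  have z: "z A \<in> A" if "A \<in> \<A>" for A
    using nonempty[OF that] by (simp add: z_def some_in_eq)
  define Z where "Z = z ` (\<A> - {A1})"
  have "inj_on z (\<A> - {A1})"
    by (rule inj_onI) (metis DiffD1 disj z)
  then have cZ: "card Z = card \<A> - 1" unfolding Z_def using A1 finA by (simp add: card_image)
  have ZV: "Z \<subseteq> V - B" using z UA unfolding Z_def by blast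
  have ZA1: "Z \<inter> A1 = {}" using z disj A1(1) unfolding Z_def by blast
  define V0 where "V0 = B \<union> A1 \<union> Z"
  have V0: "V0 \<subseteq> V" "finite V0" using B A1 UA ZV finV by (auto simp: V0_def intro: finite_subset)
  have "card V = card B + sum card \<A>"
  proof -
    have "card (V - B) = sum card \<A>"
      unfolding UA[symmetric] using partition_onD2[OF part] finAi by (intro card_Union_disjoint) auto
    then show ?thesis using B finB finV card_mono[OF finV B] by (simp add: card_Diff_subset)
  qed
  \<comment> \<open>A class exceeds \<open>2 * (card A div 2)\<close> by at most one vertex, so
    there are at least \<open>card V + card B - 2 * s\<close> classes. Without the class of
    \<open>x\<close>, the lower bound on \<open>M\<close> still leaves \<open>card V - M\<close>
    representatives.\<close>
  moreover have "sum card \<A> \<le> (\<Sum>A\<in>\<A>. 2 * (card A div 2) + 1)" by (intro sum_mono) simp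
  then have "sum card \<A> \<le> 2 * (\<Sum>A\<in>\<A>. card A div 2) + card \<A>"
    by (simp only: sum.distrib sum_distrib_left card_eq_sum)
  moreover have "card \<A> \<ge> 1" using A1 finA by (metis One_nat_def Suc_leI card_gt_0_iff empty_iff)
  ultimately have "card V - M \<le> card Z" using def M cZ by simp
  then obtain Z' where Z': "Z' \<subseteq> Z" "card Z' = card V - M" "finite Z'"
    using obtain_subset_with_card_n by blast
  define V1 where "V1 = V0 - Z'"
  have xV1: "x \<in> V1" using A1 ZA1 Z' by (auto simp: V1_def V0_def)
  have V1: "V1 \<subseteq> V0" "finite V1" using V0 by (auto simp: V1_def)
  have "card V1 = card V0 - card Z'"
    unfolding V1_def using Z' by (intro card_Diff_subset) (auto simp: V0_def)
  moreover have "card V0 \<le> card V" using V0 finV by (simp add: card_mono)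
  moreover have "card Z' \<le> card V0" using Z' V0 by (intro card_mono) (auto simp: V0_def)
  moreover have cV0: "card (V - V0) = card V - card V0" using V0 by (simp add: card_Diff_subset)
  ultimately have sizes: "card V1 + card (V - V0) = M" using Z'(2) M(2) by simp
  have "card (cliques E V (Suc r)) \<le> card (cliques E V0 (Suc r)) + card (V - V0) * deg x"
    using finV V0 x(2) by (intro card_cliques_le_subset) (auto simp: deg_def V0_def)
  moreover have "card (cliques E V0 (Suc r))
      \<le> card (cliques E V1 (Suc r)) + card (V0 - V1) * tur r k (card B)"
  proof (intro card_cliques_le_subset V0 V1)
    fix y assume "y \<in> V0 - V1"
    then have "y \<in> Z" using Z' by (auto simp: V1_def)
    then obtain A where A: "A \<in> \<A>" "A \<noteq> A1" "y = z A" by (auto simp: Z_def)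
    have yV: "y \<in> V" using \<open>y \<in> Z\<close> ZV by blast
    \<comment> \<open>The neighbours of \<open>y\<close> lie in \<open>B\<close> or in its own
      class, of which \<open>V0\<close> contains \<open>y\<close> alone.\<close>
    have "nbrs E V0 y \<subseteq> B"
    proof
      fix u assume u: "u \<in> nbrs E V0 y"
      then have uBA: "u \<in> B \<union> A" using nb[OF A(1)] z[OF A(1)] A(3) nbrs_mono[OF V0(1), of E y] by blast
      show "u \<in> B"
      proof (rule ccontr)
        assume "u \<notin> B"
        then have "u \<in> A" using uBA by simp
        then have "u \<notin> A1" using disj[OF A(1) A1(1)] A(2) by blast
        then have "u \<in> Z" using u \<open>u \<notin> B\<close> by (auto simp: nbrs_def V0_def)
        then obtain A' where "A' \<in> \<A>" "u = z A'" by (auto simp: Z_def)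
        then have "u = y" using disj[OF A(1), of A' u] z \<open>u \<in> A\<close> A(3) by blast
        then show False using u by (simp add: nbrs_def)
      qed
    qed
    then have "card (nbrs E V0 y) \<le> card B" using finB by (simp add: card_mono)
    moreover have "cliques E (nbrs E V y) (Suc k) = {}"
      by (rule cliques_nbrs_empty[OF finV yV free])
    then have "cliques E (nbrs E V0 y) (Suc k) = {}"
      using cliques_mono[OF nbrs_mono[OF V0(1), of E y], of E "Suc k"] by simp
    then have "card (cliques E (nbrs E V0 y) r) \<le> tur r k (card (nbrs E V0 y))"
      using V0(2) by (intro zykov finite_nbrs)
    ultimately show "card (cliques E (nbrs E V0 y) r) \<le> tur r k (card B)"
      using tur_mono le_trans by blast
  qed
  moreover have "V0 - V1 = Z'" using Z'(1) by (auto simp: V1_def V0_def)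
  moreover have "card (cliques E V1 (Suc r)) + card (V - V0) * deg x \<le> tur (Suc r) (Suc k) M"
  proof -
    \<comment> \<open>All neighbours of \<open>x\<close> survive in \<open>V1\<close>, so a clone of
      \<open>x\<close> there accounts for the whole of \<open>deg x\<close>.\<close>
    have "B \<union> A1 \<subseteq> V1" using ZV ZA1 Z'(1) by (auto simp: V1_def V0_def)
    then have "nbrs E V x = nbrs E V1 x"
      using nb[OF A1] V1(1) V0(1) by (auto simp: nbrs_def)
    moreover have "cliques E V1 (Suc (Suc k)) = {}"
      using free cliques_mono[of V1 V E "Suc (Suc k)"] V1 V0 by auto
    ultimately show ?thesis
      using zykov_clones[OF V1(2) _ xV1, of E "Suc k" r "card (V - V0)"] sizes by (simp add: deg_def)
  qed
  ultimately show ?thesis using Z'(2) by simp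
qed

text \<open>\<open>Y - Y div Suc (Suc k)\<close> grows by at most one per step, so it takes the
  value \<open>s\<close> on the way to \<open>n - 1\<close>. \<open>Suc Y\<close> is the
  \<open>X\<close> of the overview: its Turan graph with \<open>Suc (Suc k)\<close> parts has
  \<open>s\<close> vertices outside a largest part.\<close>

lemma ex_balanced_part:
  fixes s n k :: nat
  assumes "n \<ge> 2 * s + 1"
  obtains Y where "Y < n" "Y - Y div Suc (Suc k) = s"
proof -
  define g where "g Y = Y - Y div Suc (Suc k)" for Y
  have "(n - 1) div Suc (Suc k) \<le> (n - 1) div 2" by (intro div_le_mono2) auto
  then have top: "s \<le> g (n - 1)" using assms by (simp add: g_def)
  define Y where "Y = (LEAST Y. s \<le> g Y)"
  have Y: "s \<le> g Y" "Y \<le> n - 1" unfolding Y_def by (rule LeastI[of _ "n - 1"], rule top) (rule Least_le, rule top)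
  moreover have "g Y \<le> s"
  proof (cases Y)
    case 0
    then show ?thesis by (simp add: g_def)
  next
    case (Suc Y')
    then have "\<not> s \<le> g Y'" unfolding Y_def by (metis lessI not_less_Least)
    moreover have "g (Suc Y') \<le> Suc (g Y')"
      using div_le_dividend[of Y' "Suc (Suc k)"] by (simp add: g_def div_Suc Suc_diff_le)
    ultimately show ?thesis using Suc by simp
  qed
  ultimately show ?thesis using that[of Y] assms by (simp add: g_def)
qed

theorem card_cliques_bounded_matching:
  assumes G: "simple_graph (V, E)" and free: "cliques E V (Suc (Suc (Suc k))) = {}"
    and matching: "\<And>M. is_matching E M \<Longrightarrow> card M \<le> s"
    and n: "card V \<ge> 2 * s + 1"
  shows "card (cliques E V (Suc (Suc r))) \<le> max (tur (Suc (Suc r)) (Suc (Suc k)) (2 * s + 1))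
      (tur (Suc (Suc r)) (Suc k) s + (card V - s) * tur (Suc r) (Suc k) s)"
proof -
  let ?T = "tur (Suc (Suc r)) (Suc (Suc k))" and ?e = "tur (Suc r) (Suc k)"
  let ?n = "card V"
  have "\<exists>B \<A>. B \<subseteq> V \<and> partition_on (V - B) \<A> \<and>
      (\<forall>e\<in>E. e \<inter> B = {} \<longrightarrow> (\<exists>A\<in>\<A>. e \<subseteq> A)) \<and> card B + (\<Sum>A\<in>\<A>. card A div 2) \<le> s"
    by (rule tutte_berge[OF G matching])
  then obtain B \<A> where B: "B \<subseteq> V" "partition_on (V - B) \<A>"
      "\<forall>e\<in>E. e \<inter> B = {} \<longrightarrow> (\<exists>A\<in>\<A>. e \<subseteq> A)" "card B + (\<Sum>A\<in>\<A>. card A div 2) \<le> s"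
    by (elim exE conjE) (rule that)
  note bound = card_cliques_le_barrier[OF G free B, where r = "Suc r"]
  let ?b = "card B"
  have bs: "?b \<le> s" using B(4) by simp
  obtain Y where Y: "Y < ?n" "Y - Y div Suc (Suc k) = s" using ex_balanced_part[OF n] .
  have "Suc (Y div Suc (Suc k)) = Suc Y - s"
    using Y(2) div_le_dividend[of Y "Suc (Suc k)"] by linarith
  then have "?T (Suc Y) = tur (Suc (Suc r)) (Suc k) s + (Suc Y - s) * ?e s"
    using tur_remove_largest_part[of "Suc r" "Suc k" Y] Y(2) by simp
  moreover have "s \<le> Y" using Y(2) by simp
  then have "Suc Y - s + (?n - Suc Y) = ?n - s" using Y(1) by simp
  \<comment> \<open>The remaining \<open>?n - Suc Y\<close> vertices enlarge the largest part of the
    Turan graph on \<open>Suc Y\<close> vertices, each being adjacent to the \<open>s\<close>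
    vertices outside it.\<close>
  ultimately have X: "?T (Suc Y) + (?n - Suc Y) * ?e s =
      tur (Suc (Suc r)) (Suc k) s + (?n - s) * ?e s"
    by (metis add.assoc add_mult_distrib)
  show ?thesis
  proof (cases "2 * s + 1 - ?b \<le> Suc Y")
    case True
    have "card (cliques E V (Suc (Suc r))) \<le> ?T (Suc Y) + (?n - Suc Y) * ?e ?b"
      using True Y(1) by (intro bound) auto
    also have "\<dots> \<le> ?T (Suc Y) + (?n - Suc Y) * ?e s" using bs tur_mono by (simp del: tur.simps)
    finally show ?thesis using X by simp
  next
    case False
    define a where "a = ?n - (2 * s + 1)"
    \<comment> \<open>The bound for \<open>m = 2 * s + 1 - b\<close>, for which
      \<open>?n - m = a + b\<close>.\<close>
    define f where "f b = ?T (2 * s + 1 - b) + (a + b) * ?e b" for b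
    define c where "c = 2 * s + 1 - Suc Y"
    have c: "?b \<le> c" "c \<le> s" using False \<open>s \<le> Y\<close> by (auto simp: c_def)
    have "f ?b \<le> max (f 0) (f c)"
    proof (rule convex_le_max_endpoints)
      fix b assume b: "Suc b < c"
      define m where "m = 2 * s + 1 - Suc (Suc b)"
      have m: "2 * s + 1 - Suc b = Suc m" "2 * s + 1 - b = Suc (Suc m)" using b c by (auto simp: m_def)
      \<comment> \<open>A nonnegative increasing affine factor times a nondecreasing convex function
        is convex; monotonicity handles the cross term, by comparing \<open>?e b\<close> with
        \<open>?e (Suc (Suc b))\<close>.\<close>
      have "2 * ((a + Suc b) * ?e (Suc b)) = (a + Suc b) * (2 * ?e (Suc b))" by simp
      also have "\<dots> \<le> (a + Suc b) * (?e b + ?e (Suc (Suc b)))"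
        by (intro mult_le_mono2 tur_convex)
      also have "\<dots> = (a + b) * ?e b + (a + Suc b) * ?e (Suc (Suc b)) + ?e b"
        by (simp add: algebra_simps del: tur.simps)
      also have "\<dots> \<le> (a + b) * ?e b + (a + Suc b) * ?e (Suc (Suc b)) + ?e (Suc (Suc b))"
        by (intro add_left_mono tur_mono) simp
      also have "\<dots> = (a + b) * ?e b + (a + Suc (Suc b)) * ?e (Suc (Suc b))"
        by (simp add: algebra_simps del: tur.simps)
      finally have "2 * ?T (Suc m) + 2 * ((a + Suc b) * ?e (Suc b)) \<le> (?T m + ?T (Suc (Suc m)))
          + ((a + b) * ?e b + (a + Suc (Suc b)) * ?e (Suc (Suc b)))"
        by (intro add_mono tur_convex)
      then show "2 * f (Suc b) \<le> f b + f (Suc (Suc b))"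
        unfolding f_def m m_def[symmetric] by (simp only: distrib_left ac_simps)
    qed (rule c)
    moreover have "card (cliques E V (Suc (Suc r))) \<le> f ?b"
    proof -
      have "?n - (2 * s + 1 - ?b) = a + ?b" using n bs by (simp add: a_def)
      then show ?thesis using bound[of "2 * s + 1 - ?b"] n unfolding f_def by simp
    qed
    \<comment> \<open>The second summand vanishes because \<open>?e 0\<close> counts cliques of
      positive size in the graph without vertices.\<close>
    moreover have "f 0 = ?T (2 * s + 1)" by (simp add: f_def)
    moreover have "f c \<le> ?T (Suc Y) + (?n - Suc Y) * ?e s"
    proof -
      have "2 * s + 1 - c = Suc Y" "a + c = ?n - Suc Y" using False n by (auto simp: a_def c_def)
      then show ?thesis unfolding f_def using tur_mono[OF c(2)] by (simp del: tur.simps)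
    qed
    ultimately show ?thesis using X by linarith
  qed
qed

subsection \<open>Extremal graphs\<close>

text \<open>\<open>bichromatic\<close> joins elements of the whole type; restricting both ends to
  \<open>V\<close> gives a graph with vertex set \<open>V\<close> and the same cliques
  there.\<close>

definition colour_graph :: "'a set \<Rightarrow> ('a \<Rightarrow> 'c) \<Rightarrow> 'a graph" where
  "colour_graph V c = (V, {{u, v} | u v. u \<in> V \<and> v \<in> V \<and> c u \<noteq> c v})"

lemma simple_graph_colour_graph: "finite V \<Longrightarrow> simple_graph (colour_graph V c)"
  by (auto simp: simple_graph_def colour_graph_def card_2_iff)

lemma cliques_colour_graph:
  "cliques (edges (colour_graph V c)) V r = cliques (bichromatic c) V r"
  by (rule cliques_cong) (auto simp: colour_graph_def doubleton_eq_iff)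

text \<open>A clique uses every colour at most once, and fewer than \<open>r\<close> colours are
  available.\<close>

lemma cliques_colour_graph_empty:
  assumes "finite V" "c ` V \<subseteq> C" "finite C" "card C < r"
  shows "cliques (edges (colour_graph V c)) V r = {}"
proof -
  have False if "S \<in> cliques (bichromatic c) V r" for S
  proof -
    have "card S \<le> card C"
      using inj_on_clique_bichromatic[OF that] that assms
      by (intro card_inj_on_le[of c]) (auto simp: cliques_def)
    then show False using that assms(4) by (simp add: cliques_def)
  qed
  then show ?thesis unfolding cliques_colour_graph by blast
qed

lemma turan_graph_eq: "turan_graph k m = colour_graph {..<m} (\<lambda>i. i mod k)"
  by (simp add: turan_graph_def colour_graph_def)

lemma num_copies_turan_graph:
  assumes "k > 0"
  shows "num_copies (turan_graph k m) (complete_graph r) = tur r k m"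
proof -
  have "verts (turan_graph k m) = {..<m}" by (simp add: turan_graph_def)
  then show ?thesis
    using num_copies_complete_graph[OF simple_graph_turan_graph, of k m r] card_cliques_residues[OF assms]
    by (simp add: turan_graph_eq cliques_colour_graph)
qed

lemma num_copies_G_graph:
  assumes "k > 0"
  shows "num_copies (G_graph (Suc k) n s) (complete_graph (Suc r)) =
     tur (Suc r) k s + (n - s) * tur r k s"
proof -
  \<comment> \<open>The empty side of the join gets the additional colour \<open>k\<close> and the
    Turan side its residues below \<open>k\<close>, so the join is complete multipartite with
    respect to \<open>c\<close>.\<close>
  define c :: "nat + nat \<Rightarrow> nat" where "c = case_sum (\<lambda>_. k) (\<lambda>j. j mod k)"
  let ?G = "G_graph (Suc k) n s" and ?W = "Inr ` {..<s} :: (nat + nat) set"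
    and ?P = "Inl ` {..<n - s} :: (nat + nat) set"
  have verts: "verts ?G = ?W \<union> ?P"
    by (auto simp: G_graph_def graph_join_def empty_graph_def turan_graph_def)
  have edges: "edges ?G = (`) Inr ` edges (turan_graph k s) \<union> {{Inl u, Inr v} | u v. u < n - s \<and> v < s}"
    by (simp add: G_graph_def graph_join_def empty_graph_def turan_graph_def)
  have edge: "{u, v} \<in> edges ?G \<longleftrightarrow> {u, v} \<in> bichromatic c" if "u \<in> ?W \<union> ?P" "v \<in> ?W \<union> ?P" for u v
  proof -
    have rr: "{Inr i, Inr j} \<in> edges ?G \<longleftrightarrow> i mod k \<noteq> j mod k" if "i < s" "j < s" for i j
    proof
      assume "{Inr i, Inr j} \<in> edges ?G"
      moreover have "{Inr i, Inr j} \<notin> {{Inl u, Inr v :: nat + nat} | u v. u < n - s \<and> v < s}"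
        by (simp add: doubleton_eq_iff)
      ultimately have "Inr ` {i, j} \<in> (`) (Inr :: nat \<Rightarrow> nat + nat) ` edges (turan_graph k s)"
        unfolding edges image_insert image_empty by (meson UnE)
      then have "{i, j} \<in> edges (turan_graph k s)"
        by (metis (no_types, lifting) imageE inj_Inr inj_image_eq_iff)
      then show "i mod k \<noteq> j mod k" by (auto simp: turan_graph_def doubleton_eq_iff)
    next
      assume "i mod k \<noteq> j mod k"
      then have "{i, j} \<in> edges (turan_graph k s)" using that by (auto simp: turan_graph_def)
      then have "Inr ` {i, j} \<in> (`) (Inr :: nat \<Rightarrow> nat + nat) ` edges (turan_graph k s)" by (rule imageI)
      then show "{Inr i, Inr j} \<in> edges ?G" unfolding edges by simp
    qed
    have lr: "{Inl i, Inr j} \<in> edges ?G" if "i < n - s" "j < s" for i j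
      unfolding edges using that by blast
    have "\<exists>v. Inr v \<in> e" if "e \<in> edges ?G" for e
      using that unfolding edges by (auto simp: turan_graph_def)
    then have ll: "{Inl i, Inl j} \<notin> edges ?G" for i j
      by (metis (no_types, lifting) empty_iff insert_iff sum.distinct(1))
    have ne: "j mod k \<noteq> k" for j using mod_less_divisor[OF assms, of j] by simp
    show ?thesis
    proof (cases u)
      case u: (Inl i)
      show ?thesis
      proof (cases v)
        case (Inl j)
        then show ?thesis using u ll by (simp add: c_def)
      next
        case (Inr j)
        have "i < n - s" "j < s" using that u Inr by auto
        then show ?thesis using u Inr lr[of i j] ne[of j] by (simp add: c_def)
      qed
    next
      case u: (Inr i)
      show ?thesis
      proof (cases v)
        case (Inl j)
        have "j < n - s" "i < s" using that u Inl by auto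
        then show ?thesis using u Inl lr[of j i] ne[of i] by (simp add: c_def insert_commute)
      next
        case (Inr j)
        have "i < s" "j < s" using that u Inr by auto
        then show ?thesis using u Inr rr[of i j] by (simp add: c_def)
      qed
    qed
  qed
  have W: "card (cliques (bichromatic c) ?W r) = tur r k s" for r
  proof -
    have "{v \<in> ?W. c v = i} = Inr ` {j \<in> {..<s}. j mod k = i}" for i by (auto simp: c_def)
    then have size: "card {v \<in> ?W. c v = i} = card {j \<in> {..<s}. j mod k = i}" for i
      by (simp add: card_image)
    have "c ` ?W \<subseteq> {..<k}" using assms by (auto simp: c_def)
    then have "card (cliques (bichromatic c) ?W r) = tur r (card {..<k}) (card ?W)"
      by (intro card_cliques_balanced) (simp_all only: size, simp_all add: card_residue_class[unfolded lessThan_iff])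
    then show ?thesis by (simp add: card_image)
  qed
  have "simple_graph ?G"
    unfolding G_graph_def
    by (intro simple_graph_graph_join simple_graph_empty_graph simple_graph_turan_graph)
  then have "num_copies ?G (complete_graph (Suc r)) = card (cliques (bichromatic c) (?W \<union> ?P) (Suc r))"
    using cliques_cong[OF edge] by (simp only: num_copies_complete_graph verts)
  also have "\<dots> = card (cliques (bichromatic c) ?W (Suc r)) + card ?P * card (cliques (bichromatic c) ?W r)"
  proof (rule card_cliques_add_colour_class[where i = k])
    show "c w \<noteq> k" if "w \<in> ?W" for w
      using that mod_less_divisor[OF assms] by (auto simp: c_def ) (metis nat_neq_iff)
  qed (auto simp: c_def)
  finally show ?thesis by (simp add: W card_image)
qed

section \<open>Forbidden subgraphs and lower bounds for the extremal number\<close>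

lemma free_of_clique_matchingI:
  assumes "simple_graph G" "cliques (edges G) (verts G) k = {}"
    and "\<And>M. is_matching (edges G) M \<Longrightarrow> card M \<noteq> m"
  shows "free_of {complete_graph k, matching_graph m} G"
proof -
  have "copies G (complete_graph k) = {}" using copies_complete_graph[OF assms(1)] assms(2) by simp
  moreover have "copies G (matching_graph m) = {}"
    using copy_of_matching_graphD assms(3) by blast
  ultimately show ?thesis by (simp add: free_of_def)
qed

lemma free_of_clique_matchingD:
  assumes G: "simple_graph G" and free: "free_of {complete_graph k, matching_graph (Suc s)} G"
  shows "cliques (edges G) (verts G) k = {}" and "is_matching (edges G) M \<Longrightarrow> card M \<le> s"
proof -
  show "cliques (edges G) (verts G) k = {}"
    using free copies_complete_graph[OF G, of k] by (simp add: free_of_def)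
  assume M: "is_matching (edges G) M"
  show "card M \<le> s"
  proof (rule ccontr)
    assume "\<not> ?thesis"
    then obtain N where "N \<subseteq> M" "card N = Suc s"
      using obtain_subset_with_card_n[of "Suc s" M] by auto
    then show False
      using copies_matching_graph_nonempty[OF G is_matching_subset[OF M]] free
      by (simp add: free_of_def)
  qed
qed

lemma gen_ex_ge:
  fixes G :: "nat graph"
  assumes "simple_graph G" "card (verts G) = n" "free_of \<H> G"
  shows "num_copies G T \<le> gen_ex n T \<H>"
  unfolding gen_ex_def using assms by (intro Max_ge finite_gen_ex_values) blast

text \<open>A clique with at least two vertices avoids isolated vertices, so a graph may be padded
  with them up to \<open>n\<close> vertices.\<close>

lemma cliques_edges_subset:
  assumes "simple_graph (W, E)" "W \<subseteq> V" "r \<ge> 2"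
  shows "cliques E V r = cliques E W r"
proof
  show "cliques E V r \<subseteq> cliques E W r"
  proof
    fix S assume S: "S \<in> cliques E V r"
    have "u \<in> W" if "u \<in> S" for u
    proof -
      have "\<not> S \<subseteq> {u}" using S assms(3) card_mono[of "{u}" S] by (auto simp: cliques_def)
      then obtain v where "v \<in> S" "u \<noteq> v" by blast
      then have "{u, v} \<in> E" using S that by (auto simp: cliques_def)
      then show ?thesis using assms(1) by (auto simp: simple_graph_def)
    qed
    then show "S \<in> cliques E W r" using S by (auto simp: cliques_def)
  qed
qed (rule cliques_mono[OF assms(2)])

text \<open>The witness is the Turan graph on \<open>2 * s + 1\<close> vertices padded with isolated
  vertices; a matching of \<open>s + 1\<close> edges would cover \<open>2 * s + 2\<close>
  nonisolated vertices.\<close>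

lemma gen_ex_ge_turan:
  assumes "n \<ge> 2 * s + 1" "k > 0" "r \<ge> 2"
  shows "tur r k (2 * s + 1) \<le> gen_ex n (complete_graph r) {complete_graph (Suc k), matching_graph (Suc s)}"
proof -
  define E where "E = edges (turan_graph k (2 * s + 1))"
  have W: "simple_graph ({..<2 * s + 1}, E)"
    using simple_graph_turan_graph[of k "2 * s + 1"] by (simp add: E_def simple_graph_def turan_graph_def)
  have "{..<2 * s + 1} \<subseteq> {..<n}" using assms(1) by auto
  with W have G: "simple_graph ({..<n}, E)"
    unfolding simple_graph_def fst_conv snd_conv by (meson finite_lessThan subset_trans)
  have cl: "cliques E {..<n} j = cliques E {..<2 * s + 1} j" if "j \<ge> 2" for j
    using assms(1) that by (intro cliques_edges_subset[OF W]) auto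
  have "cliques E {..<2 * s + 1} (Suc k) = {}"
    unfolding E_def turan_graph_eq using assms(2)
    by (intro cliques_colour_graph_empty[where C = "{..<k}"]) auto
  then have K: "cliques E {..<n} (Suc k) = {}" using cl[of "Suc k"] assms(2) by simp
  have "card M \<noteq> Suc s" if "is_matching E M" for M
  proof -
    have "\<Union>M \<subseteq> {..<2 * s + 1}" using that W by (auto simp: is_matching_def simple_graph_def)
    then have "card (\<Union>M) \<le> card {..<2 * s + 1}" by (intro card_mono) auto
    then show ?thesis using card_Union_matching(3)[OF W that] by simp
  qed
  then have "free_of {complete_graph (Suc k), matching_graph (Suc s)} ({..<n}, E)"
    using G K by (intro free_of_clique_matchingI) auto
  then have "num_copies ({..<n}, E) (complete_graph r) \<le>
      gen_ex n (complete_graph r) {complete_graph (Suc k), matching_graph (Suc s)}"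
    using G by (intro gen_ex_ge) auto
  moreover have "num_copies ({..<n}, E) (complete_graph r) = tur r k (2 * s + 1)"
    using num_copies_complete_graph[OF G, of r] cl[OF assms(3)] card_cliques_residues[OF assms(2)]
    by (simp add: E_def turan_graph_eq cliques_colour_graph)
  ultimately show ?thesis by simp
qed

text \<open>\<open>gen_ex\<close> ranges over graphs on natural numbers while \<open>G_graph\<close>
  lives on a sum type, so the graph is rebuilt as a colouring of \<open>{..<n}\<close>. The vertices
  below \<open>s\<close> meet every edge, so a matching has at most \<open>s\<close> edges.\<close>

lemma gen_ex_ge_G_graph:
  assumes "n \<ge> s" "k > 0"
  shows "tur (Suc r) k s + (n - s) * tur r k s \<le>
    gen_ex n (complete_graph (Suc r)) {complete_graph (Suc (Suc k)), matching_graph (Suc s)}"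
proof -
  define c where "c i = (if i < s then i mod k else k)" for i
  let ?G = "colour_graph {..<n} c"
  have G: "simple_graph ?G" and V: "verts ?G = {..<n}"
    by (simp_all add: simple_graph_colour_graph) (simp add: colour_graph_def)
  have "c ` {..<n} \<subseteq> {..<Suc k}" using assms(2) by (auto simp: c_def less_Suc_eq)
  then have K: "cliques (edges ?G) (verts ?G) (Suc (Suc k)) = {}"
    unfolding V by (intro cliques_colour_graph_empty[where C = "{..<Suc k}"]) auto
  have "card M \<noteq> Suc s" if M: "is_matching (edges ?G) M" for M
  proof -
    have "\<exists>i. i \<in> e \<and> i < s" if "e \<in> M" for e
    proof -
      have "e \<in> edges ?G" using that M by (auto simp: is_matching_def)
      then obtain u v where "e = {u, v}" "c u \<noteq> c v" by (auto simp: colour_graph_def)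
      then show ?thesis by (auto simp: c_def split: if_splits)
    qed
    then obtain p where p: "\<And>e. e \<in> M \<Longrightarrow> p e \<in> e \<and> p e < s" by metis
    have "inj_on p M"
    proof (rule inj_onI, rule ccontr)
      fix e e' assume e: "e \<in> M" "e' \<in> M" "p e = p e'" "e \<noteq> e'"
      then have "e \<inter> e' = {}" using M by (simp add: is_matching_def pairwise_def disjnt_def)
      then show False using p[OF e(1)] p[OF e(2)] e(3) by auto
    qed
    then have "card M \<le> card {..<s}" using p by (intro card_inj_on_le[of p]) auto
    then show ?thesis by simp
  qed
  then have "free_of {complete_graph (Suc (Suc k)), matching_graph (Suc s)} ?G"
    using G K by (intro free_of_clique_matchingI) auto
  then have "num_copies ?G (complete_graph (Suc r)) \<le>
      gen_ex n (complete_graph (Suc r)) {complete_graph (Suc (Suc k)), matching_graph (Suc s)}"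
    using G V by (intro gen_ex_ge) auto
  moreover have "num_copies ?G (complete_graph (Suc r)) = tur (Suc r) k s + (n - s) * tur r k s"
  proof -
    have W: "card (cliques (bichromatic c) {..<s} r) = tur r k s" for r
      using card_cliques_residues[OF assms(2), of s r]
        cliques_cong[of "{..<s}" "bichromatic c" "bichromatic (\<lambda>i. i mod k)" r]
      by (simp add: c_def)
    have "num_copies ?G (complete_graph (Suc r)) = card (cliques (bichromatic c) {..<n} (Suc r))"
      using num_copies_complete_graph[OF G] by (simp only: V cliques_colour_graph)
    also have "\<dots> = card (cliques (bichromatic c) ({..<s} \<union> {s..<n}) (Suc r))"
      using assms(1) by (simp add: ivl_disj_un_one(2))
    also have "\<dots> = card (cliques (bichromatic c) {..<s} (Suc r))
        + card {s..<n} * card (cliques (bichromatic c) {..<s} r)"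
    proof (rule card_cliques_add_colour_class[where i = k])
      show "c w \<noteq> k" if "w \<in> {..<s}" for w
        using that mod_less_divisor[OF assms(2), of w] by (simp add: c_def)
    qed (auto simp: c_def)
    finally show ?thesis by (simp add: W)
  qed
  ultimately show ?thesis by simp
qed

theorem theorem1p4:
  fixes n s k r :: nat
  assumes "s \<ge> 1" and "n \<ge> 2 * s + 1" and "k \<ge> r" and "r \<ge> 3"
  shows "gen_ex n (complete_graph r) {complete_graph (k + 1), matching_graph (s + 1)} =
    max (num_copies (turan_graph k (2 * s + 1)) (complete_graph r))
        (num_copies (G_graph k n s) (complete_graph r))"
proof -
  obtain k' where k: "k = Suc (Suc k')" using assms that[of "k - 2"] by simp
  obtain r' where r: "r = Suc (Suc r')" using assms that[of "r - 2"] by simp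
  let ?H = "{complete_graph (k + 1), matching_graph (s + 1)}"
  let ?t = "tur r k (2 * s + 1)" and ?g = "tur r (Suc k') s + (n - s) * tur (Suc r') (Suc k') s"
  have t: "num_copies (turan_graph k (2 * s + 1)) (complete_graph r) = ?t"
    by (rule num_copies_turan_graph) (simp add: k)
  have g: "num_copies (G_graph k n s) (complete_graph r) = ?g"
    unfolding k r by (rule num_copies_G_graph) simp
  have ge: "?t \<le> gen_ex n (complete_graph r) ?H"
    using gen_ex_ge_turan[of s n k r] assms by simp
  moreover have "?g \<le> gen_ex n (complete_graph r) ?H"
    using gen_ex_ge_G_graph[of s n "Suc k'" "Suc r'"] assms by (simp add: k r del: tur.simps)
  moreover have "gen_ex n (complete_graph r) ?H \<le> max ?t ?g"
  proof -
    let ?N = "{num_copies G (complete_graph r) | G :: nat graph.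
        simple_graph G \<and> card (verts G) = n \<and> free_of ?H G}"
    have "x \<le> max ?t ?g" if N: "x \<in> ?N" for x
    proof -
      obtain G :: "nat graph" where x: "x = num_copies G (complete_graph r)"
        and G: "simple_graph G" "card (verts G) = n" "free_of ?H G"
        using N by blast
      have "free_of {complete_graph (k + 1), matching_graph (Suc s)} G" using G(3) by simp
      note free = free_of_clique_matchingD[OF G(1) this]
      have "card (cliques (edges G) (verts G) r) \<le> max ?t ?g"
        unfolding k r G(2)[symmetric]
      proof (rule card_cliques_bounded_matching)
        show "simple_graph (verts G, edges G)" using G(1) by simp
        show "cliques (edges G) (verts G) (Suc (Suc (Suc k'))) = {}" using free(1) by (simp add: k)
        show "card M \<le> s" if "is_matching (edges G) M" for M using free(2) that .
        show "2 * s + 1 \<le> card (verts G)" using G(2) assms(2) by simp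
      qed
      then show ?thesis using x num_copies_complete_graph[OF G(1)] by simp
    qed
    \<comment> \<open>Bounding \<open>Max\<close> by its elements requires a nonempty set; the
      edgeless graph supplies a member.\<close>
    moreover have "?N \<noteq> {}"
    proof -
      have "simple_graph (empty_graph n)" by (rule simple_graph_empty_graph)
      moreover have "card (verts (empty_graph n)) = n" by (simp add: empty_graph_def)
      moreover have "free_of ?H (empty_graph n)"
      proof (rule free_of_clique_matchingI)
        have "cliques {} {..<n} (k + 1) = cliques {} {} (k + 1)"
          by (rule cliques_edges_subset) (auto simp: simple_graph_def k)
        then show "cliques (edges (empty_graph n)) (verts (empty_graph n)) (k + 1) = {}"
          by (simp add: empty_graph_def cliques_empty_Suc)
        show "card M \<noteq> s + 1" if "is_matching (edges (empty_graph n)) M" for M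
          using that by (simp add: is_matching_def empty_graph_def)
      qed (rule simple_graph_empty_graph)
      ultimately show ?thesis by blast
    qed
    ultimately show ?thesis unfolding gen_ex_def by (intro Max.boundedI finite_gen_ex_values)
  qed
  ultimately show ?thesis unfolding t g by (simp only: le_antisym max.bounded_iff)
qed

end
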